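(* Let $(X,G)$ be a dynamical system, i.e. $X$ is a uniform space and $G$ is a subgroup of $\mathrm{Aut}(X)$, and let $E$ be a finite symmetric generating subset of $G$ containing the identity map. If the topological entropy of $(X,G)$ with respect to $E$ satisfies $\eta_E(X,G)=0$, then $\omega(X,G)=1$ and $(X,G)$ is amenable, where $\omega(X,G)$ denotes the asymptotic uniform complexity.
   Context: Set notation: $\mathcal{P}(X)$ is the power set of $X$ and $\mathcal{F}(G)$ the set of finite subsets of $G$. For $\mathcal{U},\mathcal{V}\subseteq\mathcal{P}(X)$, write $\mathcal{U}\preceq\mathcal{V}$ ("$\mathcal{V}$ refines $\mathcal{U}$") if every $V\in\mathcal{V}$ is contained in some $U\in\mathcal{U}$; $\mathcal{U}\vee\mathcal{V}=\{U\cap V\mid U\in\mathcal{U},V\in\mathcal{V}\}$, and more generally $\bigvee_{i\in I}\mathcal{U}_i=\{\bigcap_{i\in I}U_i\mid (U_i)_{i\in I}\in\prod_{i\in I}\mathcal{U}_i\}$. For $S\subseteq X$ put $\mathrm{St}(S,\mathcal{U})=\bigcup\{U\in\mathcal{U}\mid U\cap S\neq\emptyset\}$ and $\mathcal{U}^{\ast}=\{\mathrm{St}(U,\mathcal{U})\mid U\in\mathcal{U}\}$; write $\mathcal{U}\preceq^{\ast}\mathcal{V}$ if $\mathcal{U}\preceq\mathcal{V}^{\ast}$. A covering of $X$ is a $\mathcal{U}\subseteq\mathcal{P}(X)$ with $\bigcup\mathcal{U}=X$. Uniform spaces (via coverings): a uniformity on $X$ is a non-empty set $\mathcal{D}$ of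 coverings of $X$ such that (1) if $\mathcal{U}\in\mathcal{D}$ and $\mathcal{V}$ is a covering of $X$ with $\mathcal{V}\preceq\mathcal{U}$, then $\mathcal{V}\in\mathcal{D}$; (2) for all $\mathcal{U},\mathcal{V}\in\mathcal{D}$ there is $\mathcal{W}\in\mathcal{D}$ with $\mathcal{U}\preceq^{\ast}\mathcal{W}$ and $\mathcal{V}\preceq^{\ast}\mathcal{W}$. A uniform space is a non-empty set $X$ with a uniformity, whose elements are called uniform coverings. $\mathcal{N}(X)$ is the set of finite uniform coverings of $X$. A map $f\colon X\to Y$ of uniform spaces is uniformly continuous if $f^{-1}(\mathcal{U})=\{f^{-1}(U)\mid U\in\mathcal{U}\}$ is a uniform covering of $X$ for each uniform covering $\mathcal{U}$ of $Y$. $\mathrm{Aut}(X)$ is the group of bijections $X\to X$ that are uniformly continuous with uniformly continuous inverse. For $g\in\mathrm{Aut}(X)$, $g(\mathcal{V})=\{g(V)\mid V\in\mathcal{V}\}$. Uniform complexity: for $\mathcal{U}\in\mathcal{N}(X)$, $N(\mathcal{U})=\inf\{|\mathcal{V}|\mid\mathcal{V}\in\mathcal{N}(X),\ \mathcal{U}\preceq\mathcal{V}\}$. Topological entropy: for $E$ a finite symmetric ($E=E^{-1}$) generating subset of $G$ containing the identity map, $$\eta_E(X,G)=\sup_{\mathcal{U}\in\mathcal{N}(X)}\ \limsup_{n\to\infty}\frac{\log_2 N\left(\bigvee_{g\in E^n}g(\mathcal{U})\right)}{n},$$ where $E^n=\{g_1\cdots g_n\mid g_1,\dots,g_n\in E\}$.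 Asymptotic uniform complexity: $$\omega(X,G)=\sup_{E\in\mathcal{F}(G)}\ \sup_{\mathcal{U}\in\mathcal{N}(X)}\ \inf\left\{\sup_{g\in E}\frac{N(\mathcal{V}\vee g(\mathcal{V}))}{N(\mathcal{V})}\ \middle|\ \mathcal{V}\in\mathcal{N}(X),\ \mathcal{U}\preceq\mathcal{V}\right\}$$ (empty suprema are taken in the extended reals; $E=\emptyset$ does not affect the value). Amenability: $UC_b(X)$ is the space of bounded uniformly continuous functions $X\to\mathbb{R}$ ($\mathbb{R}$ with its usual metric uniformity). $(X,G)$ is amenable if there is a linear map $m\colon UC_b(X)\to\mathbb{R}$ with $\inf_{x\in X} f(x)\leq m(f)\leq\sup_{x\in X} f(x)$ and $m(f\circ g)=m(f)$ for all $f\in UC_b(X)$ and $g\in G$. *)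

theory Defs
  imports "HOL-Analysis.Analysis" "HOL-Algebra.Bij" "HOL-Algebra.Generated_Groups"
begin

section \<open>Coverings\<close>

definition covering_of :: "'a set \<Rightarrow> 'a set set \<Rightarrow> bool"
  where "covering_of X \<U> \<longleftrightarrow> \<Union>\<U> = X"

text \<open>The second argument is the finer one.\<close>

definition refined_by :: "'a set set \<Rightarrow> 'a set set \<Rightarrow> bool"  (infix \<open>\<preceq>\<close> 50)
  where "\<U> \<preceq> \<V> \<longleftrightarrow> (\<forall>V\<in>\<V>. \<exists>U\<in>\<U>. V \<subseteq> U)"

definition cov_join :: "'a set set \<Rightarrow> 'a set set \<Rightarrow> 'a set set"
  where "cov_join \<U> \<V> = {U \<inter> V | U V. U \<in> \<U> \<and> V \<in> \<V>}"

text \<open>Intersections are formed within \<open>X\<close>, so that an empty intersection is \<open>X\<close>.\<close>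

definition cov_Join :: "'a set \<Rightarrow> 'i set \<Rightarrow> ('i \<Rightarrow> 'a set set) \<Rightarrow> 'a set set"
  where "cov_Join X I \<U> = {X \<inter> (\<Inter>i\<in>I. U i) | U. U \<in> PiE I \<U>}"

definition star :: "'a set \<Rightarrow> 'a set set \<Rightarrow> 'a set"
  where "star S \<U> = \<Union>{U\<in>\<U>. U \<inter> S \<noteq> {}}"

definition star_covering :: "'a set set \<Rightarrow> 'a set set"
  where "star_covering \<U> = {star U \<U> | U. U \<in> \<U>}"

definition star_refined_by :: "'a set set \<Rightarrow> 'a set set \<Rightarrow> bool"  (infix \<open>\<preceq>\<^sup>*\<close> 50)
  where "\<U> \<preceq>\<^sup>* \<V> \<longleftrightarrow> \<U> \<preceq> star_covering \<V>"

section \<open>Uniform spaces\<close>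

definition cov_uniformity :: "'a set \<Rightarrow> 'a set set set \<Rightarrow> bool"
  where "cov_uniformity X \<D> \<longleftrightarrow>
    \<D> \<noteq> {} \<and> (\<forall>\<U>\<in>\<D>. covering_of X \<U>) \<and>
    (\<forall>\<U> \<V>. \<U> \<in> \<D> \<longrightarrow> covering_of X \<V> \<longrightarrow> \<V> \<preceq> \<U> \<longrightarrow> \<V> \<in> \<D>) \<and>
    (\<forall>\<U>\<in>\<D>. \<forall>\<V>\<in>\<D>. \<exists>\<W>\<in>\<D>. \<U> \<preceq>\<^sup>* \<W> \<and> \<V> \<preceq>\<^sup>* \<W>)"

definition cov_uniform_space :: "'a set \<Rightarrow> 'a set set set \<Rightarrow> bool"
  where "cov_uniform_space X \<D> \<longleftrightarrow> X \<noteq> {} \<and> cov_uniformity X \<D>"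

definition finite_uniform_coverings :: "'a set set set \<Rightarrow> 'a set set set"
  where "finite_uniform_coverings \<D> = {\<U>\<in>\<D>. finite \<U>}"

definition cov_uniformly_continuous ::
    "'a set \<Rightarrow> 'a set set set \<Rightarrow> 'b set \<Rightarrow> 'b set set set \<Rightarrow> ('a \<Rightarrow> 'b) \<Rightarrow> bool"
  where "cov_uniformly_continuous X \<D> Y \<E> f \<longleftrightarrow>
    f \<in> X \<rightarrow> Y \<and> (\<forall>\<U>\<in>\<E>. {f -` U \<inter> X | U. U \<in> \<U>} \<in> \<D>)"

text \<open>The metric uniformity consists of the coverings that have a Lebesgue number.\<close>

definition metric_cov_uniformity :: "'a::metric_space set set set"
  where "metric_cov_uniformity =
    {\<U>. covering_of UNIV \<U> \<and> (\<exists>e>0. \<forall>x. \<exists>U\<in>\<U>. ball x e \<subseteq> U)}"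

lemma cov_uniformity_metric:
  "cov_uniformity UNIV (metric_cov_uniformity :: 'a::metric_space set set set)"
proof -
  let ?D = "metric_cov_uniformity :: 'a set set set"
  have balls: "range (\<lambda>x::'a. ball x e) \<in> ?D" if "e > 0" for e
    using that by (auto simp: metric_cov_uniformity_def covering_of_def intro!: exI[of _ e])
  have star: "\<U> \<preceq>\<^sup>* range (\<lambda>x::'a. ball x (d/3))"
    if d: "\<forall>x. \<exists>U\<in>\<U>. ball x e \<subseteq> U" "d \<le> e" for \<U> and d e :: real
    unfolding star_refined_by_def refined_by_def
  proof
    fix S assume "S \<in> star_covering (range (\<lambda>x::'a. ball x (d/3)))"
    then obtain x where S: "S = star (ball x (d/3)) (range (\<lambda>x::'a. ball x (d/3)))"
      by (auto simp: star_covering_def)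
    have "S \<subseteq> ball x e"
    proof
      fix y assume "y \<in> S"
      then obtain z w where "dist z y < d/3" "dist z w < d/3" "dist x w < d/3"
        by (auto simp: S star_def)
      moreover have "dist x y \<le> dist x w + dist z w + dist z y"
        by (metis dist_commute dist_triangle2 add.commute add_left_mono order_trans
            add.assoc dist_triangle)
      ultimately show "y \<in> ball x e" using d by simp
    qed
    then show "\<exists>U\<in>\<U>. S \<subseteq> U" using d by (meson order_trans)
  qed
  have "\<exists>\<W>\<in>?D. \<U> \<preceq>\<^sup>* \<W> \<and> \<V> \<preceq>\<^sup>* \<W>"
    if U: "\<U> \<in> ?D" and V: "\<V> \<in> ?D" for \<U> \<V>
  proof -
    obtain e1 where e1: "e1 > 0" "\<forall>x. \<exists>U\<in>\<U>. ball x e1 \<subseteq> U"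
      using U by (auto simp: metric_cov_uniformity_def)
    obtain e2 where e2: "e2 > 0" "\<forall>x. \<exists>U\<in>\<V>. ball x e2 \<subseteq> U"
      using V by (auto simp: metric_cov_uniformity_def)
    show ?thesis
      using star[OF e1(2), of "min e1 e2"] star[OF e2(2), of "min e1 e2"]
        balls[of "min e1 e2 / 3"] e1(1) e2(1)
      by (intro bexI[of _ "range (\<lambda>x. ball x (min e1 e2 / 3))"]) auto
  qed
  moreover have "\<V> \<in> ?D" if U: "\<U> \<in> ?D" and V: "covering_of UNIV \<V>" "\<V> \<preceq> \<U>" for \<U> \<V>
  proof -
    obtain e where e: "e > 0" "\<forall>x. \<exists>U\<in>\<U>. ball x e \<subseteq> U"
      using U by (auto simp: metric_cov_uniformity_def)
    have "\<forall>x. \<exists>V\<in>\<V>. ball x e \<subseteq> V"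
      using e(2) V(2) unfolding refined_by_def by (meson order_trans)
    then show ?thesis using e(1) V(1) by (auto simp: metric_cov_uniformity_def)
  qed
  moreover have "?D \<noteq> {}" using balls[of 1] by auto
  ultimately show ?thesis
    unfolding cov_uniformity_def by (auto simp: metric_cov_uniformity_def)
qed

section \<open>The automorphism group and dynamical systems\<close>

text \<open>As in \<^const>\<open>Bij\<close>, a self-map of \<open>X\<close> is represented by its extensional version.\<close>

definition uniform_automorphisms :: "'a set \<Rightarrow> 'a set set set \<Rightarrow> ('a \<Rightarrow> 'a) set"
  where "uniform_automorphisms X \<D> =
    {g \<in> Bij X. cov_uniformly_continuous X \<D> X \<D> g \<and>
                cov_uniformly_continuous X \<D> X \<D> (inv_into X g)}"

definition UAut :: "'a set \<Rightarrow> 'a set set set \<Rightarrow> ('a \<Rightarrow> 'a) monoid"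
  where "UAut X \<D> = BijGroup X \<lparr>carrier := uniform_automorphisms X \<D>\<rparr>"

lemma cov_uniformly_continuous_cong:
  assumes "\<And>x. x \<in> X \<Longrightarrow> f x = g x"
  shows "cov_uniformly_continuous X \<D> Y \<E> f \<longleftrightarrow> cov_uniformly_continuous X \<D> Y \<E> g"
proof -
  have "f -` U \<inter> X = g -` U \<inter> X" for U using assms by auto
  moreover have "f \<in> X \<rightarrow> Y \<longleftrightarrow> g \<in> X \<rightarrow> Y" using assms by (auto simp: Pi_iff)
  ultimately show ?thesis by (simp add: cov_uniformly_continuous_def)
qed

lemma cov_uniformly_continuous_comp:
  assumes f: "cov_uniformly_continuous X \<D> Y \<E> f"
    and g: "cov_uniformly_continuous Y \<E> Z \<F> g"
  shows "cov_uniformly_continuous X \<D> Z \<F> (\<lambda>x. g (f x))"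
  unfolding cov_uniformly_continuous_def
proof (intro conjI ballI)
  have fX: "f \<in> X \<rightarrow> Y" and gY: "g \<in> Y \<rightarrow> Z"
    using f g by (auto simp: cov_uniformly_continuous_def)
  then show "(\<lambda>x. g (f x)) \<in> X \<rightarrow> Z" by auto
  fix \<U> assume "\<U> \<in> \<F>"
  then have "{f -` V \<inter> X | V. V \<in> {g -` U \<inter> Y | U. U \<in> \<U>}} \<in> \<D>"
    using f g unfolding cov_uniformly_continuous_def by meson
  moreover have eq: "f -` (g -` U \<inter> Y) \<inter> X = (\<lambda>x. g (f x)) -` U \<inter> X" for U
    using fX by auto
  have "{f -` V \<inter> X | V. V \<in> {g -` U \<inter> Y | U. U \<in> \<U>}} =
      {f -` (g -` U \<inter> Y) \<inter> X | U. U \<in> \<U>}"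
    by blast
  then have "{f -` V \<inter> X | V. V \<in> {g -` U \<inter> Y | U. U \<in> \<U>}} =
      {(\<lambda>x. g (f x)) -` U \<inter> X | U. U \<in> \<U>}"
    by (simp only: eq)
  ultimately show "{(\<lambda>x. g (f x)) -` U \<inter> X | U. U \<in> \<U>} \<in> \<D>" by simp
qed

lemma uniform_automorphisms_subgroup:
  assumes D: "cov_uniform_space X \<D>"
  shows "subgroup (uniform_automorphisms X \<D>) (BijGroup X)"
proof (rule subgroup.intro)
  show "uniform_automorphisms X \<D> \<subseteq> carrier (BijGroup X)"
    by (auto simp: uniform_automorphisms_def BijGroup_def)
next
  fix f g
  assume f: "f \<in> uniform_automorphisms X \<D>" and g: "g \<in> uniform_automorphisms X \<D>"
  have Bij: "f \<in> Bij X" "g \<in> Bij X"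
    using f g by (auto simp: uniform_automorphisms_def)
  then have bij: "bij_betw f X X" "bij_betw g X X" by (auto simp: Bij_def)
  have 1: "cov_uniformly_continuous X \<D> X \<D> (compose X f g)"
  proof -
    have "cov_uniformly_continuous X \<D> X \<D> (\<lambda>x. f (g x))"
      using f g cov_uniformly_continuous_comp[of X \<D> X \<D> g X \<D> f]
      by (simp add: uniform_automorphisms_def)
    then show ?thesis
      by (subst cov_uniformly_continuous_cong[of X _ "\<lambda>x. f (g x)"]) (auto simp: compose_def)
  qed
  have "inv_into X (compose X f g) x = inv_into X g (inv_into X f x)" if x: "x \<in> X" for x
  proof (rule inv_into_f_eq)
    show "inj_on (compose X f g) X"
      using compose_Bij[OF Bij] by (simp add: Bij_def bij_betw_def)
    have a: "inv_into X f x \<in> X" using bij x by (simp add: bij_betw_def inv_into_into)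
    then show b: "inv_into X g (inv_into X f x) \<in> X"
      using bij by (simp add: bij_betw_def inv_into_into)
    show "compose X f g (inv_into X g (inv_into X f x)) = x"
      using a b x bij by (simp add: compose_def bij_betw_def f_inv_into_f)
  qed
  then have 2: "cov_uniformly_continuous X \<D> X \<D> (inv_into X (compose X f g))"
    using f g cov_uniformly_continuous_comp[of X \<D> X \<D> "inv_into X f" X \<D> "inv_into X g"]
    by (subst cov_uniformly_continuous_cong[of X _ "\<lambda>x. inv_into X g (inv_into X f x)"])
      (auto simp: uniform_automorphisms_def)
  show "f \<otimes>\<^bsub>BijGroup X\<^esub> g \<in> uniform_automorphisms X \<D>"
    using 1 2 Bij compose_Bij[OF Bij] by (simp add: uniform_automorphisms_def BijGroup_def)
next
  have cov: "\<And>\<U>. \<U> \<in> \<D> \<Longrightarrow> \<Union>\<U> = X"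
    using D by (auto simp: cov_uniform_space_def cov_uniformity_def covering_of_def)
  have eq: "{(\<lambda>x. x) -` U \<inter> X | U. U \<in> \<U>} = \<U>" if "\<U> \<in> \<D>" for \<U>
  proof -
    have "(\<lambda>x. x) -` U \<inter> X = U" if "U \<in> \<U>" for U using cov[OF \<open>\<U> \<in> \<D>\<close>] that by auto
    then show ?thesis by (auto; metis)
  qed
  have id: "cov_uniformly_continuous X \<D> X \<D> (\<lambda>x. x)"
    using eq by (auto simp: cov_uniformly_continuous_def)
  have 1: "cov_uniformly_continuous X \<D> X \<D> (\<lambda>x\<in>X. x)"
    using id by (subst cov_uniformly_continuous_cong[of X _ "\<lambda>x. x"]) auto
  have "inv_into X (\<lambda>x\<in>X. x) x = x" if "x \<in> X" for x
    using that by (intro inv_into_f_eq) (auto simp: inj_on_def)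
  then have 2: "cov_uniformly_continuous X \<D> X \<D> (inv_into X (\<lambda>x\<in>X. x))"
    using id by (subst cov_uniformly_continuous_cong[of X _ "\<lambda>x. x"]) auto
  show "\<one>\<^bsub>BijGroup X\<^esub> \<in> uniform_automorphisms X \<D>"
    using 1 2 id_Bij[of X] by (simp add: uniform_automorphisms_def BijGroup_def)
next
  fix f assume f: "f \<in> uniform_automorphisms X \<D>"
  then have Bij: "f \<in> Bij X" by (simp add: uniform_automorphisms_def)
  let ?h = "\<lambda>x\<in>X. inv_into X f x"
  have bij: "bij_betw f X X" using Bij by (simp add: Bij_def)
  have 1: "cov_uniformly_continuous X \<D> X \<D> ?h"
    using f by (subst cov_uniformly_continuous_cong[of X _ "inv_into X f"])
      (auto simp: uniform_automorphisms_def)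
  have "inv_into X ?h x = f x" if x: "x \<in> X" for x
  proof (rule inv_into_f_eq)
    show "inj_on ?h X"
      using restrict_inv_into_Bij[OF Bij] by (simp add: Bij_def bij_betw_def)
    show fx: "f x \<in> X" using bij x by (auto simp: bij_betw_def)
    show "?h (f x) = x" using fx x bij by (simp add: bij_betw_def)
  qed
  then have 2: "cov_uniformly_continuous X \<D> X \<D> (inv_into X ?h)"
    using f by (subst cov_uniformly_continuous_cong[of X _ f])
      (auto simp: uniform_automorphisms_def)
  show "inv\<^bsub>BijGroup X\<^esub> f \<in> uniform_automorphisms X \<D>"
    using 1 2 restrict_inv_into_Bij[OF Bij]
    by (simp add: inv_BijGroup[OF Bij] uniform_automorphisms_def)
qed

lemma group_UAut: "cov_uniform_space X \<D> \<Longrightarrow> group (UAut X \<D>)"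
  unfolding UAut_def
  by (rule group.subgroup_imp_group[OF group_BijGroup uniform_automorphisms_subgroup])

definition dynamical_system :: "'a set \<Rightarrow> 'a set set set \<Rightarrow> ('a \<Rightarrow> 'a) set \<Rightarrow> bool"
  where "dynamical_system X \<D> G \<longleftrightarrow> cov_uniform_space X \<D> \<and> subgroup G (UAut X \<D>)"

definition finite_symmetric_generating_set ::
    "'a set \<Rightarrow> 'a set set set \<Rightarrow> ('a \<Rightarrow> 'a) set \<Rightarrow> ('a \<Rightarrow> 'a) set \<Rightarrow> bool"
  where "finite_symmetric_generating_set X \<D> G E \<longleftrightarrow>
    finite E \<and> E \<subseteq> G \<and> E = (\<lambda>g. inv\<^bsub>UAut X \<D>\<^esub> g) ` E \<and> generate (UAut X \<D>) E = G"

definition image_covering :: "('a \<Rightarrow> 'b) \<Rightarrow> 'a set set \<Rightarrow> 'b set set"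
  where "image_covering g \<V> = {g ` V | V. V \<in> \<V>}"

section \<open>Complexity and entropy\<close>

definition uniform_complexity :: "'a set set set \<Rightarrow> 'a set set \<Rightarrow> nat"
  where "uniform_complexity \<D> \<U> =
    Inf {card \<V> | \<V>. \<V> \<in> finite_uniform_coverings \<D> \<and> \<U> \<preceq> \<V>}"

definition set_power :: "('g, 'm) monoid_scheme \<Rightarrow> 'g set \<Rightarrow> nat \<Rightarrow> 'g set"
  where "set_power M E n =
    {foldr (\<lambda>g h. g \<otimes>\<^bsub>M\<^esub> h) gs \<one>\<^bsub>M\<^esub> | gs. length gs = n \<and> set gs \<subseteq> E}"

definition topological_entropy ::
    "'a set \<Rightarrow> 'a set set set \<Rightarrow> ('a \<Rightarrow> 'a) set \<Rightarrow> ereal"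
  where "topological_entropy X \<D> E =
    (SUP \<U>\<in>finite_uniform_coverings \<D>.
      limsup (\<lambda>n. ereal (log 2 (real (uniform_complexity \<D>
        (cov_Join X (set_power (UAut X \<D>) E n) (\<lambda>g. image_covering g \<U>)))) / real n)))"

definition asymptotic_uniform_complexity ::
    "'a set set set \<Rightarrow> ('a \<Rightarrow> 'a) set \<Rightarrow> ereal"
  where "asymptotic_uniform_complexity \<D> G =
    (SUP E\<in>{E. finite E \<and> E \<subseteq> G}. SUP \<U>\<in>finite_uniform_coverings \<D>.
      INF \<V>\<in>{\<V>\<in>finite_uniform_coverings \<D>. \<U> \<preceq> \<V>}.
        SUP g\<in>E. ereal (real (uniform_complexity \<D> (cov_join \<V> (image_covering g \<V>)))
                         / real (uniform_complexity \<D> \<V>)))"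

section \<open>Amenability\<close>

text \<open>Functions on \<open>X\<close> are again represented by their extensional versions, so the vector space
  operations on them and precomposition are restricted to \<open>X\<close>.\<close>

definition UC_b :: "'a set \<Rightarrow> 'a set set set \<Rightarrow> ('a \<Rightarrow> real) set"
  where "UC_b X \<D> = {f \<in> extensional X. bounded (f ` X) \<and>
    cov_uniformly_continuous X \<D> UNIV metric_cov_uniformity f}"

definition amenable :: "'a set \<Rightarrow> 'a set set set \<Rightarrow> ('a \<Rightarrow> 'a) set \<Rightarrow> bool"
  where "amenable X \<D> G \<longleftrightarrow> (\<exists>m :: ('a \<Rightarrow> real) \<Rightarrow> real.
    (\<forall>f\<in>UC_b X \<D>. \<forall>h\<in>UC_b X \<D>. m (\<lambda>x\<in>X. f x + h x) = m f + m h) \<and>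
    (\<forall>f\<in>UC_b X \<D>. \<forall>c. m (\<lambda>x\<in>X. c * f x) = c * m f) \<and>
    (\<forall>f\<in>UC_b X \<D>. (INF x\<in>X. f x) \<le> m f \<and> m f \<le> (SUP x\<in>X. f x)) \<and>
    (\<forall>f\<in>UC_b X \<D>. \<forall>g\<in>G. m (compose X f g) = m f))"

end

theory Submission
  imports Defs
begin

text \<open>Fix a finite set \<open>F\<close> of group elements, a finite uniform covering \<open>\<U>\<close> and \<open>e > 0\<close>. Since \<open>E\<close>
generates \<open>G\<close>, is symmetric and contains the identity, \<open>F\<close> lies in some power of \<open>E\<close>, say the \<open>m\<close>-th.
Let \<open>V n\<close> be the join of the translates of \<open>\<U>\<close> by the elements of the \<open>n\<close>-th power of \<open>E\<close>. Zero
entropy means that \<open>N (V n)\<close> grows subexponentially, so for some \<open>n\<close> the quotient of \<open>N (V (n + m))\<close>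
by \<open>N (V n)\<close> is at most \<open>1 + e\<close>. As \<open>V (n + m)\<close> refines both \<open>V n\<close> and its translates by
elements of \<open>F\<close>, the covering \<open>V n\<close> is almost invariant under \<open>F\<close> in the sense of uniform complexity
(\<open>almost_invariant_covering\<close>). As \<open>F\<close>, \<open>\<U>\<close> and \<open>e\<close> are arbitrary,
the asymptotic uniform complexity is at most \<open>1\<close>.

For amenability, let \<open>\<U>\<close> now be an almost invariant covering, fine enough for the given
functions to vary little on its members. Choose a point in each member of a refinement of \<open>\<U>\<close> of
least cardinality \<open>N \<U>\<close>, and average over these points. Exchanging members between two refinements shows
that averages over refinements of nearly minimal cardinality nearly agree
(\<open>sum_over_covering_le\<close>): by minimality the two families of members satisfy Hall's condition for the
relation of meeting each other, and members that meet carry almost the same value. A minimal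
refinement of the join of \<open>\<U>\<close> and \<open>g(\<U>)\<close> is nearly minimal for both \<open>\<U>\<close> and \<open>g(\<U>)\<close>, so the average and
its translate by \<open>g\<close> nearly agree (\<open>sum_almost_invariant\<close>). A limit of such averages exists because
the linear means form a compact set for pointwise convergence (\<open>compact_linear_means\<close>), and it
is an invariant mean.\<close>

section \<open>Finite uniform coverings\<close>

lemma refined_by_trans: "\<U> \<preceq> \<V> \<Longrightarrow> \<V> \<preceq> \<W> \<Longrightarrow> \<U> \<preceq> \<W>"
  unfolding refined_by_def by (meson order_trans)

lemma cov_join_refines: "\<U> \<preceq> cov_join \<U> \<V>" "\<V> \<preceq> cov_join \<U> \<V>"
  by (auto simp: refined_by_def cov_join_def)

lemma refined_by_cov_joinI: "\<U> \<preceq> \<W> \<Longrightarrow> \<V> \<preceq> \<W> \<Longrightarrow> cov_join \<U> \<V> \<preceq> \<W>"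
  unfolding refined_by_def cov_join_def
proof (intro ballI)
  fix W assume "\<forall>V\<in>\<W>. \<exists>U\<in>\<U>. V \<subseteq> U" "\<forall>V\<in>\<W>. \<exists>U\<in>\<V>. V \<subseteq> U" "W \<in> \<W>"
  then obtain U V where "U \<in> \<U>" "V \<in> \<V>" "W \<subseteq> U" "W \<subseteq> V" by meson
  then show "\<exists>S\<in>{U \<inter> V |U V. U \<in> \<U> \<and> V \<in> \<V>}. W \<subseteq> S" by auto
qed

locale covering_uniform_space =
  fixes X :: "'a set" and \<D> :: "'a set set set"
  assumes uniform_space: "cov_uniform_space X \<D>"
begin

abbreviation fin_unif :: "'a set set set"
  where "fin_unif \<equiv> finite_uniform_coverings \<D>"

abbreviation N :: "'a set set \<Rightarrow> nat"
  where "N \<equiv> uniform_complexity \<D>"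

lemma fin_unifD:
  assumes "\<U> \<in> fin_unif"
  shows "finite \<U>" "\<U> \<in> \<D>" "\<Union>\<U> = X" "U \<in> \<U> \<Longrightarrow> U \<subseteq> X"
  using assms uniform_space
  by (auto simp: finite_uniform_coverings_def cov_uniform_space_def cov_uniformity_def
      covering_of_def)

lemma X_nonempty: "X \<noteq> {}"
  using uniform_space by (simp add: cov_uniform_space_def)

lemma uniform_coarsening:
  "\<U> \<in> \<D> \<Longrightarrow> \<Union>\<V> = X \<Longrightarrow> \<V> \<preceq> \<U> \<Longrightarrow> \<V> \<in> \<D>"
  using uniform_space
  unfolding cov_uniform_space_def cov_uniformity_def covering_of_def by blast

text \<open>A set is contained in its own star, so star-refinement is stronger than refinement.\<close>

lemma uniform_common_refinement:
  assumes "\<U> \<in> \<D>" "\<V> \<in> \<D>"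
  obtains \<W> where "\<W> \<in> \<D>" "\<U> \<preceq> \<W>" "\<V> \<preceq> \<W>"
proof -
  have star: "\<A> \<preceq> \<W>" if "\<A> \<preceq>\<^sup>* \<W>" for \<A> \<W> :: "'a set set"
    unfolding refined_by_def
  proof
    fix W assume "W \<in> \<W>"
    then have "W \<subseteq> star W \<W>" "star W \<W> \<in> star_covering \<W>"
      by (auto simp: star_def star_covering_def)
    with that show "\<exists>U\<in>\<A>. W \<subseteq> U"
      unfolding star_refined_by_def refined_by_def by (meson order_trans)
  qed
  show thesis
    using uniform_space assms star that
    unfolding cov_uniform_space_def cov_uniformity_def by metis
qed

lemma fin_unif_join:
  assumes "\<U> \<in> fin_unif" "\<V> \<in> fin_unif"
  shows "cov_join \<U> \<V> \<in> fin_unif"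
proof -
  note U = fin_unifD(1-3)[OF assms(1)] and V = fin_unifD(1-3)[OF assms(2)]
  have "\<Union>(cov_join \<U> \<V>) = \<Union>\<U> \<inter> \<Union>\<V>"
    unfolding cov_join_def by blast
  then have "\<Union>(cov_join \<U> \<V>) = X" using U V by simp
  moreover obtain \<W> where W: "\<W> \<in> \<D>" "\<U> \<preceq> \<W>" "\<V> \<preceq> \<W>"
    using uniform_common_refinement[OF U(2) V(2)] by metis
  ultimately have "cov_join \<U> \<V> \<in> \<D>"
    by (intro uniform_coarsening[OF W(1)] refined_by_cov_joinI)
  moreover have "cov_join \<U> \<V> = (\<lambda>(U, V). U \<inter> V) ` (\<U> \<times> \<V>)"
    by (auto simp: cov_join_def)
  then have "finite (cov_join \<U> \<V>)" using U V by simp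
  ultimately show ?thesis
    by (simp add: finite_uniform_coverings_def)
qed

lemma trivial_covering: "{X} \<in> fin_unif"
proof -
  obtain \<U> where U: "\<U> \<in> \<D>"
    using uniform_space by (auto simp: cov_uniform_space_def cov_uniformity_def)
  then have "\<Union>\<U> = X"
    using uniform_space by (auto simp: cov_uniform_space_def cov_uniformity_def covering_of_def)
  then have "{X} \<preceq> \<U>" by (auto simp: refined_by_def)
  then show ?thesis
    using uniform_coarsening[OF U] by (simp add: finite_uniform_coverings_def)
qed

lemma uniform_common_refinement_finite:
  assumes "finite I" "\<And>i. i \<in> I \<Longrightarrow> \<U> i \<in> fin_unif"
  obtains \<W> where "\<W> \<in> fin_unif" "\<And>i. i \<in> I \<Longrightarrow> \<U> i \<preceq> \<W>"
proof -
  have "\<exists>\<W>\<in>fin_unif. \<forall>i\<in>I. \<U> i \<preceq> \<W>"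
    using assms
  proof (induction I rule: finite_induct)
    case empty
    then show ?case using trivial_covering by auto
  next
    case (insert i I)
    then obtain \<W> where W: "\<W> \<in> fin_unif" "\<forall>j\<in>I. \<U> j \<preceq> \<W>"
      by (metis insertCI)
    let ?W = "cov_join (\<U> i) \<W>"
    have "?W \<in> fin_unif" using fin_unif_join[OF _ W(1)] insert.prems[of i] by simp
    moreover have "\<forall>j\<in>insert i I. \<U> j \<preceq> ?W"
      using W(2) cov_join_refines(1)[of "\<U> i" \<W>] cov_join_refines(2)[of \<W> "\<U> i"]
        refined_by_trans[of _ \<W> ?W] by simp
    ultimately show ?case by (rule bexI[rotated])
  qed
  then show thesis using that by metis
qed

text \<open>The join is coarser than any common refinement of the given coverings, hence uniform.\<close>

lemma fin_unif_Join:
  assumes I: "finite I" and U: "\<And>i. i \<in> I \<Longrightarrow> \<U> i \<in> fin_unif"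
  shows "cov_Join X I \<U> \<in> fin_unif"
proof -
  obtain \<W> where W: "\<W> \<in> fin_unif" "\<And>i. i \<in> I \<Longrightarrow> \<U> i \<preceq> \<W>"
    using uniform_common_refinement_finite[of I \<U>] assms by blast
  have ref: "cov_Join X I \<U> \<preceq> \<W>"
    unfolding refined_by_def
  proof
    fix W assume w: "W \<in> \<W>"
    then have "\<forall>i\<in>I. \<exists>U\<in>\<U> i. W \<subseteq> U" using W(2) by (auto simp: refined_by_def)
    then obtain u where "\<forall>i\<in>I. u i \<in> \<U> i \<and> W \<subseteq> u i" by metis
    then show "\<exists>U\<in>cov_Join X I \<U>. W \<subseteq> U"
      using fin_unifD(4)[OF W(1) w]
      by (intro bexI[of _ "X \<inter> (\<Inter>i\<in>I. restrict u I i)"])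
        (auto simp: cov_Join_def intro!: exI[of _ "restrict u I"])
  qed
  have "\<Union>(cov_Join X I \<U>) \<subseteq> X" by (auto simp: cov_Join_def)
  moreover have "X \<subseteq> \<Union>(cov_Join X I \<U>)"
    using fin_unifD(3)[OF W(1)] ref unfolding refined_by_def by blast
  moreover have "cov_Join X I \<U> = (\<lambda>U. X \<inter> (\<Inter>i\<in>I. U i)) ` PiE I \<U>"
    by (auto simp: cov_Join_def)
  moreover have "finite (PiE I \<U>)"
    using I U fin_unifD(1) by (intro finite_PiE) auto
  ultimately show ?thesis
    using uniform_coarsening[OF fin_unifD(2)[OF W(1)] _ ref]
    by (metis (mono_tags, lifting) finite_imageI finite_uniform_coverings_def mem_Collect_eq
        subset_antisym)
qed

lemma Join_refines:
  assumes "i \<in> I"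
  shows "\<U> i \<preceq> cov_Join X I \<U>"
  unfolding refined_by_def cov_Join_def using assms by (auto dest!: PiE_mem) 

section \<open>Uniform complexity\<close>

lemma N_le:
  assumes "\<V> \<in> fin_unif" "\<U> \<preceq> \<V>"
  shows "N \<U> \<le> card \<V>"
  unfolding uniform_complexity_def using assms by (intro cInf_lower) auto

text \<open>Discarding the empty set from a covering keeps it a uniform covering, so a refinement of least
cardinality has only non-empty members. Points can therefore be chosen in all of them.\<close>

lemma minimal_refinement:
  assumes "\<U> \<in> fin_unif"
  obtains \<V> where "\<V> \<in> fin_unif" "\<U> \<preceq> \<V>" "card \<V> = N \<U>" "{} \<notin> \<V>"
proof -
  let ?S = "{card \<V> | \<V>. \<V> \<in> fin_unif \<and> \<U> \<preceq> \<V>}"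
  have "\<U> \<preceq> \<U>" by (auto simp: refined_by_def)
  then have "?S \<noteq> {}" using assms by blast
  then have "Inf ?S \<in> ?S" by (rule Inf_nat_def1)
  then obtain \<V> where V: "\<V> \<in> fin_unif" "\<U> \<preceq> \<V>" "card \<V> = N \<U>"
    unfolding uniform_complexity_def by auto
  have "{} \<notin> \<V>"
  proof
    assume e: "{} \<in> \<V>"
    let ?V = "\<V> - {{}}"
    have "\<Union>?V = X" using fin_unifD(3)[OF V(1)] by auto
    moreover from this have "?V \<preceq> \<V>"
      using X_nonempty by (auto simp: refined_by_def)
    ultimately have "?V \<in> fin_unif"
      using uniform_coarsening[of \<V> ?V] fin_unifD[OF V(1)]
      by (simp add: finite_uniform_coverings_def)
    moreover have "\<U> \<preceq> ?V" using V(2) by (auto simp: refined_by_def)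
    ultimately have "N \<U> \<le> card ?V" by (rule N_le)
    then show False
      using card_Diff1_less[OF fin_unifD(1)[OF V(1)] e] V(3) by simp
  qed
  with V that show thesis by blast
qed

lemma N_mono:
  assumes "\<U> \<preceq> \<V>" "\<V> \<in> fin_unif"
  shows "N \<U> \<le> N \<V>"
  using minimal_refinement[OF assms(2)] N_le refined_by_trans[OF assms(1)] by metis

lemma N_pos:
  assumes "\<U> \<in> fin_unif"
  shows "N \<U> \<ge> 1"
proof -
  obtain \<V> where V: "\<V> \<in> fin_unif" "card \<V> = N \<U>"
    using minimal_refinement[OF assms] by metis
  then have "\<V> \<noteq> {}" using fin_unifD(3)[OF V(1)] X_nonempty by auto
  then show ?thesis using V fin_unifD(1) by (metis One_nat_def Suc_leI card_gt_0_iff)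
qed

section \<open>Comparing sums over coverings\<close>

text \<open>Replace the members \<open>\<A>\<close> of \<open>\<V>\<close> by all members of \<open>\<W>\<close> that meet one of them. The result still covers
\<open>X\<close>, refines \<open>\<U>\<close>, and is uniform because it is coarser than the join of \<open>\<V>\<close> and \<open>\<W>\<close>; so it has at
least \<open>N \<U>\<close> members. If \<open>\<V>\<close> has exactly \<open>N \<U>\<close> members, the bound is Hall's condition for matching
the members of \<open>\<V>\<close> to members of \<open>\<W>\<close> that they meet.\<close>

lemma exchange_bound:
  assumes V: "\<V> \<in> fin_unif" "\<U> \<preceq> \<V>" and W: "\<W> \<in> fin_unif" "\<U> \<preceq> \<W>"
    and A: "\<A> \<subseteq> \<V>"
  shows "N \<U> + card \<A> \<le> card \<V> + card {W\<in>\<W>. \<exists>V\<in>\<A>. V \<inter> W \<noteq> {}}"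
proof -
  let ?B = "{W\<in>\<W>. \<exists>V\<in>\<A>. V \<inter> W \<noteq> {}}"
  let ?C = "(\<V> - \<A>) \<union> ?B"
  note V' = fin_unifD[OF V(1)] and W' = fin_unifD[OF W(1)]
  have "\<Union>?C \<subseteq> X" using V'(4) W'(4) by blast
  moreover have "X \<subseteq> \<Union>?C"
  proof
    fix x assume "x \<in> X"
    then obtain V W where "V \<in> \<V>" "x \<in> V" "W \<in> \<W>" "x \<in> W" using V'(3) W'(3) by blast
    then show "x \<in> \<Union>?C" by blast
  qed
  ultimately have cov: "\<Union>?C = X" by blast
  \<comment> \<open>Empty members of the join lie in any member of the mixed family, which is inhabited.\<close>
  have "?C \<preceq> cov_join \<V> \<W>"
    unfolding refined_by_def
  proof
    fix S assume "S \<in> cov_join \<V> \<W>"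
    then obtain V W where S: "S = V \<inter> W" "V \<in> \<V>" "W \<in> \<W>" by (auto simp: cov_join_def)
    show "\<exists>U\<in>?C. S \<subseteq> U"
    proof (cases "S = {}")
      case True
      then show ?thesis using cov X_nonempty by blast
    next
      case False
      then show ?thesis using S by (cases "V \<in> \<A>") blast+
    qed
  qed
  then have "?C \<in> fin_unif"
    using uniform_coarsening[OF fin_unifD(2)[OF fin_unif_join[OF V(1) W(1)]] cov] V'(1) W'(1)
    by (simp add: finite_uniform_coverings_def)
  moreover have "\<U> \<preceq> ?C" using V(2) W(2) by (auto simp: refined_by_def)
  ultimately have "N \<U> \<le> card ?C" by (rule N_le)
  also have "\<dots> \<le> card (\<V> - \<A>) + card ?B" by (rule card_Un_le)
  also have "card (\<V> - \<A>) = card \<V> - card \<A>"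
    using A V'(1) by (meson card_Diff_subset finite_subset)
  finally show ?thesis using card_mono[OF V'(1) A] by linarith
qed

end

lemma has_integral_superlevel_indicator:
  fixes a M :: real
  assumes "0 \<le> a" "a \<le> M"
  shows "((\<lambda>t. if t < a then 1 else 0) has_integral a) {0..M}"
proof -
  have "((\<lambda>t. 1::real) has_integral (a - 0) *\<^sub>R 1) {0..a}"
    using assms by (intro has_integral_const_real[THEN has_integral_eq_rhs]) auto
  then have "((\<lambda>t. if t \<in> {0..a} then 1 else 0) has_integral a) {0..M}"
    using assms by (subst has_integral_restrict) auto
  then show ?thesis
    by (rule has_integral_spike_finite[where S="{a}", rotated 2]) auto
qed

text \<open>The layer-cake formula: a finite sum of non-negative reals is the integral over \<open>t \<ge> 0\<close> of the number
of summands exceeding \<open>t\<close>.\<close>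

lemma sum_le_of_superlevel_cards:
  fixes a :: "'i \<Rightarrow> real" and b :: "'j \<Rightarrow> real" and c M :: real
  assumes fin: "finite I" "finite J"
    and a: "\<And>i. i \<in> I \<Longrightarrow> 0 \<le> a i \<and> a i \<le> M"
    and b: "\<And>j. j \<in> J \<Longrightarrow> 0 \<le> b j \<and> b j \<le> M"
    and M: "0 \<le> M"
    and le: "\<And>t. real (card {i\<in>I. t < a i}) \<le> real (card {j\<in>J. t < b j}) + c"
  shows "sum a I \<le> sum b J + c * M"
proof (rule has_integral_le)
  show "((\<lambda>t. \<Sum>i\<in>I. if t < a i then 1 else 0) has_integral sum a I) {0..M}"
    using fin a by (intro has_integral_sum has_integral_superlevel_indicator) auto
  have "((\<lambda>t. c) has_integral (M - 0) *\<^sub>R c) {0..M}"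
    using M by (intro has_integral_const_real[THEN has_integral_eq_rhs]) auto
  then show "((\<lambda>t. (\<Sum>j\<in>J. if t < b j then 1 else 0) + c) has_integral sum b J + c * M) {0..M}"
    using fin b
    by (intro has_integral_add has_integral_sum has_integral_superlevel_indicator)
      (auto simp: mult.commute)
next
  fix t :: real
  have "(\<Sum>i\<in>I. if t < a i then 1 else (0::real)) = real (card {i\<in>I. t < a i})"
    using fin by (simp add: sum.If_cases Int_def)
  moreover have "(\<Sum>j\<in>J. if t < b j then 1 else (0::real)) = real (card {j\<in>J. t < b j})"
    using fin by (simp add: sum.If_cases Int_def)
  ultimately show "(\<Sum>i\<in>I. if t < a i then 1 else 0) \<le> (\<Sum>j\<in>J. if t < b j then 1 else 0) + c"
    using le[of t] by simp
qed

context covering_uniform_space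
begin

text \<open>Sampling \<open>f\<close> at one point of each member of a refinement of \<open>\<U>\<close> gives a sum that hardly depends on
the refinement, as long as its cardinality is close to the minimum \<open>N \<U>\<close>. If the sample in a
member of \<open>\<V>\<close> exceeds \<open>t\<close>, then the sample in any member of \<open>\<W>\<close> meeting it exceeds \<open>t - 2 * \<delta>\<close>; the
exchange bound thus compares the superlevel sets of the two families of samples, and the
layer-cake formula turns this into a comparison of the sums, without matching the members
individually.\<close>

lemma sum_over_covering_le:
  fixes f :: "'a \<Rightarrow> real" and \<delta> M :: real
  assumes V: "\<V> \<in> fin_unif" "\<U> \<preceq> \<V>" and W: "\<W> \<in> fin_unif" "\<U> \<preceq> \<W>"
    and osc: "\<And>U x y. U \<in> \<U> \<Longrightarrow> x \<in> U \<Longrightarrow> y \<in> U \<Longrightarrow> \<bar>f x - f y\<bar> \<le> \<delta>"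
    and p: "\<And>V. V \<in> \<V> \<Longrightarrow> p V \<in> V" and q: "\<And>W. W \<in> \<W> \<Longrightarrow> q W \<in> W"
    and f: "\<And>x. x \<in> X \<Longrightarrow> 0 \<le> f x \<and> f x \<le> M"
    and \<delta>: "0 \<le> \<delta>"
  shows "(\<Sum>V\<in>\<V>. f (p V)) \<le> (\<Sum>W\<in>\<W>. f (q W) + 2 * \<delta>)
      + (real (card \<V>) - real (N \<U>)) * (M + 2 * \<delta>)"
proof (rule sum_le_of_superlevel_cards)
  note V' = fin_unifD[OF V(1)] and W' = fin_unifD[OF W(1)]
  show "finite \<V>" "finite \<W>" using V' W' by auto
  show "0 \<le> f (p V) \<and> f (p V) \<le> M + 2 * \<delta>" if "V \<in> \<V>" for V
    using f[of "p V"] p[OF that] V'(4)[OF that] \<delta> by auto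
  show "0 \<le> f (q W) + 2 * \<delta> \<and> f (q W) + 2 * \<delta> \<le> M + 2 * \<delta>" if "W \<in> \<W>" for W
    using f[of "q W"] q[OF that] W'(4)[OF that] \<delta> by auto
  show "0 \<le> M + 2 * \<delta>" using f X_nonempty \<delta> by fastforce
  fix t
  let ?A = "{V\<in>\<V>. t < f (p V)}"
  have "{W\<in>\<W>. \<exists>V\<in>?A. V \<inter> W \<noteq> {}} \<subseteq> {W\<in>\<W>. t < f (q W) + 2 * \<delta>}"
  proof clarify
    fix W V z assume W: "W \<in> \<W>" and V: "V \<in> \<V>" "t < f (p V)" and "V \<inter> W \<noteq> {}"
    then obtain z where z: "z \<in> V" "z \<in> W" by auto
    have "\<bar>f (p V) - f z\<bar> \<le> \<delta>"
      using osc assms(2) V z p[OF V(1)] unfolding refined_by_def by (meson subsetD)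
    moreover have "\<bar>f z - f (q W)\<bar> \<le> \<delta>"
      using osc assms(4) W z q[OF W] unfolding refined_by_def by (meson subsetD)
    ultimately show "t < f (q W) + 2 * \<delta>" using V by linarith
  qed
  then have "card {W\<in>\<W>. \<exists>V\<in>?A. V \<inter> W \<noteq> {}} \<le> card {W\<in>\<W>. t < f (q W) + 2 * \<delta>}"
    using W' by (intro card_mono) auto
  then show "real (card ?A) \<le> real (card {W\<in>\<W>. t < f (q W) + 2 * \<delta>})
      + (real (card \<V>) - real (N \<U>))"
    using exchange_bound[OF V W, of ?A] by simp
qed

end

section \<open>Powers of a generating set\<close>

context group
begin

lemma foldr_mult_closed:
  "set gs \<subseteq> carrier G \<Longrightarrow> foldr (\<lambda>g h. g \<otimes> h) gs \<one> \<in> carrier G"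
  by (induction gs) auto

lemma foldr_mult_append:
  assumes "set gs \<subseteq> carrier G" "set hs \<subseteq> carrier G"
  shows "foldr (\<lambda>g h. g \<otimes> h) (gs @ hs) \<one>
    = foldr (\<lambda>g h. g \<otimes> h) gs \<one> \<otimes> foldr (\<lambda>g h. g \<otimes> h) hs \<one>"
  using assms(1)
proof (induction gs)
  case Nil
  then show ?case using foldr_mult_closed[OF assms(2)] by simp
next
  case (Cons g gs)
  then show ?case
    using foldr_mult_closed[OF assms(2)] foldr_mult_closed[of gs] by (simp add: m_assoc)
qed

lemma set_power_closed: "E \<subseteq> carrier G \<Longrightarrow> set_power G E n \<subseteq> carrier G"
  unfolding set_power_def using foldr_mult_closed by blast

lemma set_power_mult:
  assumes "E \<subseteq> carrier G" "a \<in> set_power G E m" "b \<in> set_power G E n"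
  shows "a \<otimes> b \<in> set_power G E (m + n)"
proof -
  obtain gs hs where "a = foldr (\<lambda>g h. g \<otimes> h) gs \<one>" "length gs = m" "set gs \<subseteq> E"
    "b = foldr (\<lambda>g h. g \<otimes> h) hs \<one>" "length hs = n" "set hs \<subseteq> E"
    using assms(2,3) unfolding set_power_def by blast
  then show ?thesis
    using foldr_mult_append[of gs hs] assms(1) unfolding set_power_def
    by (intro CollectI exI[of _ "gs @ hs"]) auto
qed

lemma one_mem_set_power:
  assumes "\<one> \<in> E"
  shows "\<one> \<in> set_power G E n"
proof -
  have "foldr (\<lambda>g h. g \<otimes> h) (replicate n \<one>) \<one> = \<one>" by (induction n) auto
  then show ?thesis
    unfolding set_power_def using assms
    by (intro CollectI exI[of _ "replicate n \<one>"]) auto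
qed

lemma set_power_mono:
  assumes "E \<subseteq> carrier G" "\<one> \<in> E" "m \<le> n"
  shows "set_power G E m \<subseteq> set_power G E n"
proof
  fix a assume a: "a \<in> set_power G E m"
  then have "\<one> \<otimes> a \<in> set_power G E (n - m + m)"
    using assms set_power_mult one_mem_set_power by blast
  then show "a \<in> set_power G E n"
    using set_power_closed[OF assms(1)] a assms(3) by (metis l_one le_add_diff_inverse2 subsetD)
qed

lemma finite_set_power:
  assumes "finite E"
  shows "finite (set_power G E n)"
proof -
  have "set_power G E n = (\<lambda>gs. foldr (\<lambda>g h. g \<otimes> h) gs \<one>) ` {gs. set gs \<subseteq> E \<and> length gs = n}"
    unfolding set_power_def by auto
  then show ?thesis using finite_lists_length_eq[OF assms] by simp
qed

lemma generate_imp_mem_set_power: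
  assumes E: "E \<subseteq> carrier G" "\<And>e. e \<in> E \<Longrightarrow> inv e \<in> E" and g: "g \<in> generate G E"
  shows "\<exists>n. g \<in> set_power G E n"
proof -
  have gen: "e \<in> set_power G E 1" if "e \<in> E" for e
    unfolding set_power_def using that E(1)
    by (intro CollectI exI[of _ "[e]"]) auto
  from g show ?thesis
  proof induction
    case one
    show ?case unfolding set_power_def by (intro exI[of _ 0]) auto
  next
    case (incl h)
    then show ?case using gen by blast
  next
    case (inv h)
    then show ?case using gen E(2) by blast
  next
    case (eng h1 h2)
    then show ?case using set_power_mult[OF E(1)] by blast
  qed
qed

text \<open>Because the powers of a set containing the identity increase, finitely many elements lie in a
common power.\<close>

lemma finite_subset_generate_imp_subset_set_power:
  assumes E: "E \<subseteq> carrier G" "\<And>e. e \<in> E \<Longrightarrow> inv e \<in> E" "\<one> \<in> E"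
    and F: "finite F" "F \<subseteq> generate G E"
  shows "\<exists>m>0. F \<subseteq> set_power G E m"
proof -
  have "\<forall>g\<in>F. \<exists>n. g \<in> set_power G E n"
    using generate_imp_mem_set_power[OF E(1,2)] F(2) by blast
  then obtain n where n: "\<And>g. g \<in> F \<Longrightarrow> g \<in> set_power G E (n g)" by metis
  have "g \<in> set_power G E (Suc (sum n F))" if "g \<in> F" for g
    using n[OF that] set_power_mono[OF E(1,3), of "n g" "Suc (sum n F)"]
      member_le_sum[of g F n] that F(1) by auto
  then show ?thesis by blast
qed

end

section \<open>Group actions on coverings\<close>

locale covering_dynamical_system = covering_uniform_space X \<D>
  for X :: "'a set" and \<D> +
  fixes G :: "('a \<Rightarrow> 'a) set"
  assumes subgroup: "subgroup G (UAut X \<D>)"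
begin

sublocale UAut: group "UAut X \<D>"
  by (rule group_UAut[OF uniform_space])

lemma G_carrier: "G \<subseteq> carrier (UAut X \<D>)"
  using subgroup by (rule subgroup.subset)

lemma G_automorphism:
  assumes "g \<in> G"
  shows "g \<in> Bij X" "bij_betw g X X" "cov_uniformly_continuous X \<D> X \<D> g"
    "cov_uniformly_continuous X \<D> X \<D> (inv_into X g)"
  using assms G_carrier by (auto simp: UAut_def uniform_automorphisms_def Bij_def)

lemma G_mult: "g \<in> G \<Longrightarrow> h \<in> G \<Longrightarrow> g \<otimes>\<^bsub>UAut X \<D>\<^esub> h = compose X g h"
  using G_automorphism(1) by (simp add: UAut_def BijGroup_def)

lemma UAut_one: "\<one>\<^bsub>UAut X \<D>\<^esub> = (\<lambda>x\<in>X. x)"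
  by (simp add: UAut_def BijGroup_def)

lemma G_mem:
  assumes "g \<in> G" "x \<in> X"
  shows "g x \<in> X"
  using G_automorphism(2)[OF assms(1)] assms(2) by (auto simp: bij_betw_def)

lemma G_inj: "g \<in> G \<Longrightarrow> inj_on g X"
  using G_automorphism(2) by (auto simp: bij_betw_def)

lemma vimage_image_G:
  assumes "g \<in> G" "S \<subseteq> X"
  shows "g -` (g ` S) \<inter> X = S"
proof
  show "g -` (g ` S) \<inter> X \<subseteq> S"
    using inj_onD[OF G_inj[OF assms(1)]] assms(2) by blast
  show "S \<subseteq> g -` (g ` S) \<inter> X" using assms(2) by blast
qed

lemma image_covering_eq: "image_covering g \<U> = (`) g ` \<U>"
  by (auto simp: image_covering_def)

text \<open>The image under \<open>g\<close> is the preimage under the inverse of \<open>g\<close>, which is uniformly continuous.\<close>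

lemma fin_unif_image_covering:
  assumes g: "g \<in> G" and U: "\<U> \<in> fin_unif"
  shows "image_covering g \<U> \<in> fin_unif"
proof -
  have bij: "bij_betw g X X" by (rule G_automorphism(2)[OF g])
  have eq: "inv_into X g -` S \<inter> X = g ` S" if "S \<subseteq> X" for S
  proof
    show "inv_into X g -` S \<inter> X \<subseteq> g ` S"
    proof
      fix x assume "x \<in> inv_into X g -` S \<inter> X"
      moreover from this have "g (inv_into X g x) = x"
        using bij by (simp add: bij_betw_def f_inv_into_f)
      ultimately show "x \<in> g ` S" by force
    qed
    show "g ` S \<subseteq> inv_into X g -` S \<inter> X"
      using bij that by (auto simp: bij_betw_def subset_iff)
  qed
  have "{inv_into X g -` U \<inter> X | U. U \<in> \<U>} \<in> \<D>"
    using G_automorphism(4)[OF g] fin_unifD(2)[OF U]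
    unfolding cov_uniformly_continuous_def by blast
  moreover have "{inv_into X g -` U \<inter> X | U. U \<in> \<U>} = image_covering g \<U>"
    unfolding image_covering_def using eq fin_unifD(4)[OF U] by (metis (no_types, lifting))
  ultimately show ?thesis
    using fin_unifD(1)[OF U]
    by (simp add: finite_uniform_coverings_def image_covering_eq)
qed

lemma image_covering_mono: "\<U> \<preceq> \<V> \<Longrightarrow> image_covering g \<U> \<preceq> image_covering g \<V>"
  unfolding refined_by_def image_covering_eq by (simp add: image_iff) (meson image_mono)

text \<open>A refinement of the image covering pulls back along \<open>g\<close> to a refinement of \<open>\<U>\<close> that is no larger.\<close>

lemma N_le_N_image_covering:
  assumes g: "g \<in> G" and U: "\<U> \<in> fin_unif"
  shows "N \<U> \<le> N (image_covering g \<U>)"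
proof -
  obtain \<W> where W: "\<W> \<in> fin_unif" "image_covering g \<U> \<preceq> \<W>" "card \<W> = N (image_covering g \<U>)"
    using minimal_refinement[OF fin_unif_image_covering[OF g U]] by metis
  let ?P = "{g -` W \<inter> X | W. W \<in> \<W>}"
  have P: "?P = (\<lambda>W. g -` W \<inter> X) ` \<W>" by auto
  have "?P \<in> \<D>"
    using G_automorphism(3)[OF g] fin_unifD(2)[OF W(1)]
    unfolding cov_uniformly_continuous_def by blast
  then have "?P \<in> fin_unif"
    using fin_unifD(1)[OF W(1)] P by (simp add: finite_uniform_coverings_def)
  moreover have "\<U> \<preceq> ?P"
    unfolding refined_by_def
  proof
    fix S assume "S \<in> ?P"
    then obtain W where S: "S = g -` W \<inter> X" "W \<in> \<W>" by blast
    then obtain U where u: "U \<in> \<U>" "W \<subseteq> g ` U"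
      using W(2) by (auto simp: refined_by_def image_covering_def)
    then have "S \<subseteq> U"
      using vimage_image_G[OF g fin_unifD(4)[OF U u(1)]] S(1) by blast
    then show "\<exists>U\<in>\<U>. S \<subseteq> U" using u(1) by blast
  qed
  ultimately have "N \<U> \<le> card ?P" by (rule N_le)
  also have "\<dots> \<le> card \<W>" unfolding P by (rule card_image_le[OF fin_unifD(1)[OF W(1)]])
  finally show ?thesis using W(3) by simp
qed

section \<open>Slow growth of complexity along powers\<close>

abbreviation power_join :: "('a \<Rightarrow> 'a) set \<Rightarrow> 'a set set \<Rightarrow> nat \<Rightarrow> 'a set set"
  where "power_join E \<U> n \<equiv> cov_Join X (set_power (UAut X \<D>) E n) (\<lambda>g. image_covering g \<U>)"

lemma set_power_subset_G:
  assumes "E \<subseteq> G"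
  shows "set_power (UAut X \<D>) E n \<subseteq> G"
proof
  fix a assume "a \<in> set_power (UAut X \<D>) E n"
  then obtain gs where a: "a = foldr (\<lambda>g h. g \<otimes>\<^bsub>UAut X \<D>\<^esub> h) gs \<one>\<^bsub>UAut X \<D>\<^esub>" "set gs \<subseteq> E"
    unfolding set_power_def by blast
  have "set gs \<subseteq> G \<Longrightarrow> foldr (\<lambda>g h. g \<otimes>\<^bsub>UAut X \<D>\<^esub> h) gs \<one>\<^bsub>UAut X \<D>\<^esub> \<in> G"
    by (induction gs) (auto intro: subgroup.one_closed[OF subgroup] subgroup.m_closed[OF subgroup])
  then show "a \<in> G" using a assms by auto
qed

lemma fin_unif_power_join:
  assumes "E \<subseteq> G" "finite E" "\<U> \<in> fin_unif"
  shows "power_join E \<U> n \<in> fin_unif"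
  using assms set_power_subset_G[OF assms(1)]
  by (intro fin_unif_Join UAut.finite_set_power fin_unif_image_covering) auto

lemma image_covering_id:
  assumes "\<U> \<in> fin_unif"
  shows "image_covering (\<lambda>x\<in>X. x) \<U> = \<U>"
proof -
  have "(\<lambda>x\<in>X. x) ` U = U" if "U \<in> \<U>" for U
    using fin_unifD(4)[OF assms that] by (auto simp: image_def subset_iff)
  then show ?thesis by (simp add: image_covering_eq)
qed

lemma refined_by_power_join:
  assumes "\<U> \<in> fin_unif" "(\<lambda>x\<in>X. x) \<in> E"
  shows "\<U> \<preceq> power_join E \<U> n"
  using Join_refines[OF UAut.one_mem_set_power[of E n], of "\<lambda>g. image_covering g \<U>"]
    image_covering_id[OF assms(1)] assms(2) by (simp add: UAut_one)

text \<open>Both the \<open>n\<close>-th power of \<open>E\<close> and its left translate by \<open>g\<close> are contained in the \<open>(n + m)\<close>-th power.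
This is what lets one step of length \<open>m\<close> in the sequence of joins control all translations by
elements of the \<open>m\<close>-th power at once.\<close>

lemma power_join_refines_translate:
  assumes E: "E \<subseteq> G" "(\<lambda>x\<in>X. x) \<in> E" and U: "\<U> \<in> fin_unif"
    and g: "g \<in> set_power (UAut X \<D>) E m"
  shows "cov_join (power_join E \<U> n) (image_covering g (power_join E \<U> n))
    \<preceq> power_join E \<U> (n + m)"
  unfolding refined_by_def
proof
  let ?P = "set_power (UAut X \<D>) E"
  have EG: "E \<subseteq> carrier (UAut X \<D>)" using E(1) G_carrier by blast
  have gG: "g \<in> G" using g set_power_subset_G[OF E(1)] by blast
  fix W assume "W \<in> power_join E \<U> (n + m)"
  then obtain u where u: "u \<in> PiE (?P (n + m)) (\<lambda>g. image_covering g \<U>)"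
    and W: "W = X \<inter> (\<Inter>k\<in>?P (n + m). u k)"
    unfolding cov_Join_def by blast
  have sub: "?P n \<subseteq> ?P (n + m)"
    using E(2) by (intro UAut.set_power_mono[OF EG]) (auto simp: UAut_one)
  have gP: "compose X g h \<in> ?P (n + m)" if "h \<in> ?P n" for h
    using UAut.set_power_mult[OF EG g that] G_mult[OF gG] set_power_subset_G[OF E(1)] that
    by (metis add.commute subsetD)
  \<comment> \<open>One factor of each kind: the coordinates indexed by the \<open>n\<close>-th power itself, and the
    pulled-back coordinates indexed by its translate.\<close>
  let ?A = "X \<inter> (\<Inter>h\<in>?P n. restrict u (?P n) h)"
  let ?v = "\<lambda>h\<in>?P n. g -` u (compose X g h) \<inter> X"
  let ?B = "X \<inter> (\<Inter>h\<in>?P n. ?v h)"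
  have "restrict u (?P n) \<in> PiE (?P n) (\<lambda>g. image_covering g \<U>)"
    using u sub by (auto simp: PiE_iff)
  then have A: "?A \<in> power_join E \<U> n" unfolding cov_Join_def by blast
  have "g -` u (compose X g h) \<inter> X \<in> image_covering h \<U>" if h: "h \<in> ?P n" for h
  proof -
    have hG: "h \<in> G" using h set_power_subset_G[OF E(1)] by blast
    have "u (compose X g h) \<in> image_covering (compose X g h) \<U>"
      using u gP[OF h] by (auto simp: PiE_iff)
    then obtain Z where Z: "Z \<in> \<U>" "u (compose X g h) = compose X g h ` Z"
      by (auto simp: image_covering_def)
    have ZX: "Z \<subseteq> X" using fin_unifD(4)[OF U Z(1)] .
    have hZ: "h ` Z \<subseteq> X" using ZX G_mem[OF hG] by auto
    have "compose X g h ` Z = g ` (h ` Z)"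
      unfolding image_image using ZX by (intro image_cong) (auto simp: compose_def)
    then have "g -` u (compose X g h) \<inter> X = h ` Z"
      using Z(2) vimage_image_G[OF gG hZ] by simp
    then show ?thesis using Z(1) by (auto simp: image_covering_def)
  qed
  then have "?v \<in> PiE (?P n) (\<lambda>g. image_covering g \<U>)" by auto
  then have B: "?B \<in> power_join E \<U> n" unfolding cov_Join_def by blast
  have "W \<subseteq> ?A" using W sub by auto
  moreover have "W \<subseteq> g ` ?B"
  proof
    fix w assume w: "w \<in> W"
    then have "w \<in> X" using W by blast
    then obtain y where y: "y \<in> X" "w = g y"
      using G_automorphism(2)[OF gG] by (auto simp: bij_betw_def)
    have "g y \<in> u (compose X g h)" if "h \<in> ?P n" for h
      using w W y gP[OF that] by blast
    then have "y \<in> ?B" using y(1) by simp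
    then show "w \<in> g ` ?B" using y(2) by blast
  qed
  ultimately have "W \<subseteq> ?A \<inter> g ` ?B" by (rule Int_greatest)
  moreover have "?A \<inter> g ` ?B
      \<in> cov_join (power_join E \<U> n) (image_covering g (power_join E \<U> n))"
    using A imageI[OF B, of "(`) g"] unfolding cov_join_def image_covering_eq by blast
  ultimately show "\<exists>S\<in>cov_join (power_join E \<U> n) (image_covering g (power_join E \<U> n)). W \<subseteq> S"
    by (rule bexI)
qed

end

text \<open>If every step of length \<open>m\<close> multiplied \<open>a\<close> by more than \<open>1 + e\<close>, then \<open>a\<close> would grow at an exponential
rate of at least \<open>log 2 (1 + e) / m\<close> along the multiples of \<open>m\<close>.\<close>

lemma subexponential_imp_small_step:
  fixes a :: "nat \<Rightarrow> real"
  assumes a: "\<And>n. a n \<ge> 1" and m: "m > 0" and e: "e > 0"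
    and lim: "limsup (\<lambda>n. ereal (log 2 (a n) / real n)) \<le> 0"
  shows "\<exists>n. a (n + m) \<le> (1 + e) * a n"
proof (rule ccontr)
  assume "\<not> ?thesis"
  then have step: "a (n + m) > (1 + e) * a n" for n by (simp add: not_le)
  have grow: "(1 + e) ^ k \<le> a (k * m)" for k
  proof (induction k)
    case 0
    then show ?case using a[of 0] by simp
  next
    case (Suc k)
    then have "(1 + e) * (1 + e) ^ k \<le> (1 + e) * a (k * m)"
      using e by (intro mult_left_mono) auto
    also have "\<dots> \<le> a (k * m + m)" using step[of "k * m"] by simp
    finally show ?case by (simp add: add.commute)
  qed
  let ?c = "log 2 (1 + e) / real m"
  have c: "0 < ?c" using e m by simp
  have "limsup (\<lambda>n. ereal (log 2 (a n) / real n)) < ereal ?c"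
    using lim c by (metis ereal_less(2) order_le_less_trans)
  then have "\<forall>\<^sub>F n in sequentially. ereal (log 2 (a n) / real n) < ereal ?c"
    by (rule Limsup_lessD)
  then obtain n0 where n0: "\<And>n. n \<ge> n0 \<Longrightarrow> log 2 (a n) / real n < ?c"
    by (auto simp: eventually_sequentially)
  \<comment> \<open>The successor keeps \<open>?k * m\<close> positive and beyond \<open>n0\<close>.\<close>
  let ?k = "Suc n0"
  have "?k * 1 \<le> ?k * m" using m by (intro mult_le_mono2) auto
  then have lt: "log 2 (a (?k * m)) / real (?k * m) < ?c" by (intro n0) auto
  have "real ?k * log 2 (1 + e) = log 2 ((1 + e) ^ ?k)"
    using e by (subst log_nat_power) auto
  also have "\<dots> \<le> log 2 (a (?k * m))"
    using grow[of ?k] e a[of "?k * m"] by (subst log_le_cancel_iff) (auto simp del: power_Suc)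
  finally have "real ?k * log 2 (1 + e) / real (?k * m) \<le> log 2 (a (?k * m)) / real (?k * m)"
    by (intro divide_right_mono) auto
  moreover have "real ?k * log 2 (1 + e) / real (?k * m) = ?c"
    unfolding of_nat_mult by (rule mult_divide_mult_cancel_left) simp
  ultimately show False using lt by simp
qed

context covering_dynamical_system
begin

text \<open>The covering sought is a join over a power of \<open>E\<close> at which the complexity grows slowly.\<close>

lemma almost_invariant_covering:
  assumes E: "finite_symmetric_generating_set X \<D> G E" "(\<lambda>x\<in>X. x) \<in> E"
    and ent: "topological_entropy X \<D> E \<le> 0"
    and F: "finite F" "F \<subseteq> G" and U: "\<U> \<in> fin_unif" and e: "e > 0"
  shows "\<exists>\<V>\<in>fin_unif. \<U> \<preceq> \<V> \<and>
    (\<forall>g\<in>F. real (N (cov_join \<V> (image_covering g \<V>))) \<le> (1 + e) * real (N \<V>))"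
proof -
  have EG: "E \<subseteq> G" "finite E" "generate (UAut X \<D>) E = G"
    and sym: "E = (\<lambda>g. inv\<^bsub>UAut X \<D>\<^esub> g) ` E"
    using E(1) by (auto simp: finite_symmetric_generating_set_def)
  have EC: "E \<subseteq> carrier (UAut X \<D>)" using EG(1) G_carrier by blast
  have inv: "inv\<^bsub>UAut X \<D>\<^esub> e \<in> E" if "e \<in> E" for e
    using imageI[OF that, of "\<lambda>g. inv\<^bsub>UAut X \<D>\<^esub> g"] by (simp only: sym[symmetric])
  have one: "\<one>\<^bsub>UAut X \<D>\<^esub> \<in> E" using E(2) by (simp add: UAut_one)
  obtain m where m: "m > 0" "F \<subseteq> set_power (UAut X \<D>) E m"
    using UAut.finite_subset_generate_imp_subset_set_power[OF EC inv one F(1)] F(2) EG(3)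
    by metis
  note V = fin_unif_power_join[OF EG(1,2) U]
  have "limsup (\<lambda>n. ereal (log 2 (real (N (power_join E \<U> n))) / real n)) \<le> topological_entropy X \<D> E"
    unfolding topological_entropy_def by (rule SUP_upper[OF U])
  then have "limsup (\<lambda>n. ereal (log 2 (real (N (power_join E \<U> n))) / real n)) \<le> 0"
    using ent by (rule order_trans)
  then obtain n where n: "real (N (power_join E \<U> (n + m))) \<le> (1 + e) * real (N (power_join E \<U> n))"
    using subexponential_imp_small_step[of "\<lambda>n. real (N (power_join E \<U> n))" m e] N_pos[OF V] m(1) e
    by (metis of_nat_1 of_nat_mono)
  show ?thesis
  proof (intro bexI[OF _ V[of n]] conjI ballI)
    show "\<U> \<preceq> power_join E \<U> n" by (rule refined_by_power_join[OF U E(2)])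
    fix g assume "g \<in> F"
    then have "N (cov_join (power_join E \<U> n) (image_covering g (power_join E \<U> n)))
        \<le> N (power_join E \<U> (n + m))"
      using m(2) by (intro N_mono[OF _ V] power_join_refines_translate[OF EG(1) E(2) U]) auto
    then show "real (N (cov_join (power_join E \<U> n) (image_covering g (power_join E \<U> n))))
        \<le> (1 + e) * real (N (power_join E \<U> n))"
      using n by linarith
  qed
qed

text \<open>Almost invariant coverings give the upper bound. The lower bound holds because joining a covering
with another one cannot decrease its complexity.\<close>

lemma asymptotic_uniform_complexity_eq_1:
  assumes inv: "\<And>F \<U> e. finite F \<Longrightarrow> F \<subseteq> G \<Longrightarrow> \<U> \<in> fin_unif \<Longrightarrow> (0::real) < e \<Longrightarrow>
    \<exists>\<V>\<in>fin_unif. \<U> \<preceq> \<V> \<and>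
      (\<forall>g\<in>F. real (N (cov_join \<V> (image_covering g \<V>))) \<le> (1 + e) * real (N \<V>))"
  shows "asymptotic_uniform_complexity \<D> G = 1"
proof (rule antisym)
  show "asymptotic_uniform_complexity \<D> G \<le> 1"
    unfolding asymptotic_uniform_complexity_def
  proof (intro SUP_least, rule ereal_le_epsilon2)
    fix F \<U> and e :: real
    assume F: "F \<in> {E. finite E \<and> E \<subseteq> G}" and U: "\<U> \<in> fin_unif" and e: "0 < e"
    obtain \<V> where V: "\<V> \<in> fin_unif" "\<U> \<preceq> \<V>"
      and le: "\<forall>g\<in>F. real (N (cov_join \<V> (image_covering g \<V>))) \<le> (1 + e) * real (N \<V>)"
      using inv[of F \<U> e] F U e by blast
    have "0 < real (N \<V>)" using N_pos[OF V(1)] by simp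
    then have "(SUP g\<in>F. ereal (real (N (cov_join \<V> (image_covering g \<V>))) / real (N \<V>)))
        \<le> ereal (1 + e)"
      using le by (intro SUP_least) (simp add: pos_divide_le_eq)
    then show "(INF \<V>\<in>{\<V>\<in>fin_unif. \<U> \<preceq> \<V>}.
        SUP g\<in>F. ereal (real (N (cov_join \<V> (image_covering g \<V>))) / real (N \<V>))) \<le> 1 + ereal e"
      using V by (intro INF_lower2[of \<V>]) (auto simp: one_ereal_def)
  qed
next
  let ?i = "\<lambda>x\<in>X. x"
  have i: "?i \<in> G" using subgroup.one_closed[OF subgroup] by (simp add: UAut_one)
  have "1 \<le> (INF \<V>\<in>{\<V>\<in>fin_unif. {X} \<preceq> \<V>}.
        SUP g\<in>{?i}. ereal (real (N (cov_join \<V> (image_covering g \<V>))) / real (N \<V>)))"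
  proof (intro INF_greatest)
    fix \<V> assume V: "\<V> \<in> {\<V>\<in>fin_unif. {X} \<preceq> \<V>}"
    then have "N \<V> \<le> N (cov_join \<V> (image_covering ?i \<V>))"
      using fin_unif_join fin_unif_image_covering[OF i] cov_join_refines(1)
      by (intro N_mono) auto
    moreover have "N \<V> \<ge> 1" using V N_pos by blast
    ultimately show "1 \<le> (SUP g\<in>{?i}. ereal (real (N (cov_join \<V> (image_covering g \<V>))) / real (N \<V>)))"
      by (simp add: one_ereal_def pos_le_divide_eq)
  qed
  also have "\<dots> \<le> asymptotic_uniform_complexity \<D> G"
    unfolding asymptotic_uniform_complexity_def
    using i trivial_covering by (intro SUP_upper2[of "{?i}"] SUP_upper2[of "{X}"]) auto
  finally show "1 \<le> asymptotic_uniform_complexity \<D> G" .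
qed

section \<open>Almost invariant means\<close>

text \<open>Let \<open>\<W>\<close> be a minimal refinement of the join of \<open>\<U>\<close> and \<open>g(\<U>)\<close>. It is a nearly minimal refinement of \<open>\<U>\<close>,
and also of \<open>g(\<U>)\<close>, since translating does not lower the complexity. Hence the sum of samples over
\<open>\<W>\<close> is close both to the one over \<open>\<V>\<close> and to the one over \<open>g(\<V>)\<close>, where the points
\<open>g (p V)\<close> serve as sample points. Each of the two comparisons costs \<open>2 * \<eta>\<close> per sample, and the at most
\<open>\<eta> * card \<V>\<close> surplus members of \<open>\<W>\<close> cost at most \<open>2 * B + 2 * \<eta>\<close> each; for \<open>\<eta> \<le> 1\<close> this adds up to
\<open>\<eta> * (2 * B + 8)\<close> per member of \<open>\<V>\<close>.\<close>

lemma sum_almost_invariant: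
  fixes f :: "'a \<Rightarrow> real" and \<eta> B :: real
  assumes g: "g \<in> G" and U: "\<U> \<in> fin_unif" and V: "\<V> \<in> fin_unif" "\<U> \<preceq> \<V>"
    and card: "card \<V> = N \<U>"
    and inv: "real (N (cov_join \<U> (image_covering g \<U>))) \<le> (1 + \<eta>) * real (N \<U>)"
    and \<eta>: "0 < \<eta>" "\<eta> \<le> 1"
    and B: "\<And>x. x \<in> X \<Longrightarrow> \<bar>f x\<bar> \<le> B"
    and osc: "\<And>U x y. U \<in> \<U> \<Longrightarrow> x \<in> U \<Longrightarrow> y \<in> U \<Longrightarrow> \<bar>f x - f y\<bar> \<le> \<eta>"
    and osc_g: "\<And>U x y. U \<in> \<U> \<Longrightarrow> x \<in> U \<Longrightarrow> y \<in> U \<Longrightarrow> \<bar>f (g x) - f (g y)\<bar> \<le> \<eta>"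
    and p: "\<And>V. V \<in> \<V> \<Longrightarrow> p V \<in> V"
  shows "(\<Sum>V\<in>\<V>. f (p V)) \<le> (\<Sum>V\<in>\<V>. f (g (p V))) + real (card \<V>) * (\<eta> * (2 * B + 8))"
proof -
  let ?J = "cov_join \<U> (image_covering g \<U>)"
  let ?gV = "image_covering g \<V>"
  let ?n = "real (card \<V>)"
  note gU = fin_unif_image_covering[OF g U] and gV = fin_unif_image_covering[OF g V(1)]
  obtain \<W> where W: "\<W> \<in> fin_unif" "?J \<preceq> \<W>" "card \<W> = N ?J" "{} \<notin> \<W>"
    using minimal_refinement[OF fin_unif_join[OF U gU]] by metis
  have UW: "\<U> \<preceq> \<W>" and gUW: "image_covering g \<U> \<preceq> \<W>"
    using W(2) cov_join_refines refined_by_trans by metis+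
  have "\<forall>W\<in>\<W>. \<exists>x. x \<in> W" using W(4) by (metis equals0I)
  then obtain q where q: "\<And>W. W \<in> \<W> \<Longrightarrow> q W \<in> W" by metis
  have B0: "0 \<le> B" using B X_nonempty by fastforce
  \<comment> \<open>The comparison of sums is for non-negative functions, so \<open>f\<close> is shifted by \<open>B\<close>.\<close>
  have F: "0 \<le> f x + B \<and> f x + B \<le> 2 * B" if "x \<in> X" for x
    using B[OF that] by linarith
  have "(\<Sum>V\<in>\<V>. f (p V) + B) \<le> (\<Sum>W\<in>\<W>. f (q W) + B + 2 * \<eta>)
      + (?n - real (N \<U>)) * (2 * B + 2 * \<eta>)"
    using \<eta> by (intro sum_over_covering_le[OF V W(1) UW _ p q F]) (auto dest: osc)
  then have 1: "(\<Sum>V\<in>\<V>. f (p V) + B) \<le> (\<Sum>W\<in>\<W>. f (q W) + B) + 2 * \<eta> * real (card \<W>)"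
    using card by (simp add: sum.distrib algebra_simps)
  have inj: "inj_on ((`) g) \<V>"
    using inj_on_image_Pow[OF G_inj[OF g]] fin_unifD(4)[OF V(1)] by (meson PowI inj_on_subset subsetI)
  define r where "r S = g (p (inv_into \<V> ((`) g) S))" for S
  have r: "r S \<in> S" if "S \<in> ?gV" for S
  proof -
    obtain V where "V \<in> \<V>" "S = g ` V" using \<open>S \<in> ?gV\<close> by (auto simp: image_covering_def)
    then show ?thesis using inv_into_f_f[OF inj] p unfolding r_def by auto
  qed
  have "\<bar>(f x + B) - (f y + B)\<bar> \<le> \<eta>" if "S \<in> image_covering g \<U>" "x \<in> S" "y \<in> S" for S x y
    using that osc_g by (auto simp: image_covering_def)
  then have "(\<Sum>W\<in>\<W>. f (q W) + B) \<le> (\<Sum>S\<in>?gV. f (r S) + B + 2 * \<eta>)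
      + (real (card \<W>) - real (N (image_covering g \<U>))) * (2 * B + 2 * \<eta>)"
    using \<eta> by (intro sum_over_covering_le[OF W(1) gUW gV image_covering_mono[OF V(2)] _ q r F]) auto
  also have "(\<Sum>S\<in>?gV. f (r S) + B + 2 * \<eta>) = (\<Sum>V\<in>\<V>. f (g (p V)) + B + 2 * \<eta>)"
    unfolding image_covering_eq by (subst sum.reindex[OF inj]) (simp add: r_def inv_into_f_f[OF inj])
  also have "(real (card \<W>) - real (N (image_covering g \<U>))) * (2 * B + 2 * \<eta>)
      \<le> (\<eta> * ?n) * (2 * B + 2)"
  proof (rule mult_mono)
    show "real (card \<W>) - real (N (image_covering g \<U>)) \<le> \<eta> * ?n"
      using inv W(3) card N_le_N_image_covering[OF g U] by (simp add: algebra_simps)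
  qed (use \<eta> B0 in auto)
  finally have 2: "(\<Sum>W\<in>\<W>. f (q W) + B)
      \<le> (\<Sum>V\<in>\<V>. f (g (p V)) + B) + 2 * \<eta> * ?n + (\<eta> * ?n) * (2 * B + 2)"
    by (simp add: sum.distrib algebra_simps)
  have "real (card \<W>) \<le> (1 + \<eta>) * ?n" using inv W(3) card by simp
  also have "\<dots> \<le> 2 * ?n" using \<eta> by (intro mult_right_mono) auto
  finally have "2 * \<eta> * real (card \<W>) \<le> 2 * \<eta> * (2 * ?n)"
    using \<eta> by (intro mult_left_mono) auto
  with 1 2 have "(\<Sum>V\<in>\<V>. f (p V) + B)
      \<le> (\<Sum>V\<in>\<V>. f (g (p V)) + B) + 2 * \<eta> * ?n + (\<eta> * ?n) * (2 * B + 2) + 2 * \<eta> * (2 * ?n)"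
    by linarith
  then show ?thesis by (simp add: sum.distrib algebra_simps)
qed

text \<open>Preimages of the intervals of radius \<open>\<delta> / 2\<close> around the multiples of \<open>\<delta> / 4\<close>. These intervals overlap,
which gives them a Lebesgue number.\<close>

lemma small_oscillation_covering:
  assumes f: "f \<in> UC_b X \<D>" and d: "0 < \<delta>"
  shows "\<exists>\<U>\<in>fin_unif. \<forall>U\<in>\<U>. \<forall>x\<in>U. \<forall>y\<in>U. \<bar>f x - f y\<bar> \<le> \<delta>"
proof -
  define r where "r = \<delta> / 4"
  have r: "r > 0" using d by (simp add: r_def)
  let ?b = "\<lambda>k::int. ball (of_int k * r) (2 * r)"
  let ?S = "\<lambda>k. f -` ?b k \<inter> X"
  have leb: "\<exists>k. ball x r \<subseteq> ?b k" for x :: real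
  proof
    let ?k = "\<lfloor>x / r\<rfloor>"
    have "of_int ?k * r \<le> x" "x < (of_int ?k + 1) * r"
      using floor_divide_lower[OF r] floor_divide_upper[OF r] by auto
    then show "ball x r \<subseteq> ?b ?k"
      by (auto simp: dist_real_def algebra_simps abs_less_iff)
  qed
  have "x \<in> \<Union>(range ?b)" for x
    using leb[of x] r by (meson UN_I UNIV_I centre_in_ball subsetD)
  then have "range ?b \<in> metric_cov_uniformity"
    using r leb by (auto simp: metric_cov_uniformity_def covering_of_def intro!: exI[of _ r])
  then have "{f -` U \<inter> X | U. U \<in> range ?b} \<in> \<D>"
    using f unfolding UC_b_def cov_uniformly_continuous_def by blast
  moreover have "{f -` U \<inter> X | U. U \<in> range ?b} = range ?S" by auto
  ultimately have D: "range ?S \<in> \<D>" by simp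
  obtain B where B: "\<And>x. x \<in> X \<Longrightarrow> \<bar>f x\<bar> \<le> B"
    using f by (auto simp: UC_b_def bounded_iff)
  \<comment> \<open>Only finitely many of the intervals meet the range, since \<open>f\<close> is bounded.\<close>
  have "\<bar>k\<bar> \<le> \<lceil>(B + 2 * r) / r\<rceil>" if "x \<in> ?S k" for k x
  proof -
    have "\<bar>of_int k * r\<bar> \<le> B + 2 * r"
      using that B[of x] by (auto simp: dist_real_def)
    then have "\<bar>of_int k\<bar> \<le> (B + 2 * r) / r"
      using r by (simp add: pos_le_divide_eq abs_mult)
    then show ?thesis by linarith
  qed
  then have "range ?S \<subseteq> insert {} (?S ` {k. \<bar>k\<bar> \<le> \<lceil>(B + 2 * r) / r\<rceil>})"
    by blast
  moreover have "{k. \<bar>k\<bar> \<le> \<lceil>(B + 2 * r) / r\<rceil>} = {-\<lceil>(B + 2 * r) / r\<rceil>..\<lceil>(B + 2 * r) / r\<rceil>}" by auto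
  ultimately have "finite (range ?S)" by (metis finite_atLeastAtMost_int finite_imageI finite_insert finite_subset)
  then have fin: "range ?S \<in> fin_unif" using D by (simp add: finite_uniform_coverings_def)
  have osc: "\<bar>f x - f y\<bar> \<le> \<delta>" if "x \<in> ?S k" "y \<in> ?S k" for k x y
  proof -
    have "\<bar>of_int k * r - f x\<bar> < 2 * r" "\<bar>of_int k * r - f y\<bar> < 2 * r"
      using that by (simp_all add: dist_real_def)
    then show ?thesis unfolding r_def by linarith
  qed
  have "\<bar>f x - f y\<bar> \<le> \<delta>" if "U \<in> range ?S" "x \<in> U" "y \<in> U" for U x y
    using rangeE[OF that(1)] osc that(2,3) by metis
  then show ?thesis by (intro bexI[OF _ fin] ballI)
qed

lemma UC_b_compose:
  assumes f: "f \<in> UC_b X \<D>" and g: "g \<in> G"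
  shows "compose X f g \<in> UC_b X \<D>"
proof -
  have "compose X f g ` X \<subseteq> f ` X" using G_mem[OF g] by (auto simp: compose_def)
  then have "bounded (compose X f g ` X)" using f bounded_subset by (auto simp: UC_b_def)
  moreover have "cov_uniformly_continuous X \<D> UNIV metric_cov_uniformity (\<lambda>x. f (g x))"
    using cov_uniformly_continuous_comp[OF G_automorphism(3)[OF g]] f by (auto simp: UC_b_def)
  then have "cov_uniformly_continuous X \<D> UNIV metric_cov_uniformity (compose X f g)"
    by (subst cov_uniformly_continuous_cong[of X _ "\<lambda>x. f (g x)"]) (auto simp: compose_def)
  ultimately show ?thesis by (simp add: UC_b_def compose_def)
qed

section \<open>Invariant means\<close>

text \<open>The domain is all bounded functions rather than the uniformly continuous ones: boundedness of
sums and multiples is immediate, and averages over finitely many points lie between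
the bounds of any bounded function. The value \<open>0\<close> elsewhere confines \<open>m\<close> to a compact product of intervals.\<close>

definition linear_mean :: "(('a \<Rightarrow> real) \<Rightarrow> real) \<Rightarrow> bool"
  where "linear_mean m \<longleftrightarrow>
    (\<forall>f. m f \<in> (if bounded (f ` X) then {(INF x\<in>X. f x)..(SUP x\<in>X. f x)} else {0})) \<and>
    (\<forall>f h. bounded (f ` X) \<longrightarrow> bounded (h ` X) \<longrightarrow> m (\<lambda>x\<in>X. f x + h x) = m f + m h) \<and>
    (\<forall>f c. bounded (f ` X) \<longrightarrow> m (\<lambda>x\<in>X. c * f x) = c * m f)"

text \<open>By Tychonoff's theorem the product of the intervals is compact for pointwise convergence, and
linearity is a closed condition.\<close>

lemma compact_linear_means: "compact {m. linear_mean m}"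
proof -
  let ?K = "PiE UNIV (\<lambda>f. if bounded (f ` X) then {(INF x\<in>X. f x)..(SUP x\<in>X. f x)} else {0::real})"
  have "compactin (product_topology (\<lambda>_. euclidean) UNIV) ?K"
    by (subst compactin_PiE) auto
  then have K: "compact ?K" by (simp add: euclidean_product_topology)
  let ?A = "\<Inter>f\<in>{f. bounded (f ` X)}. \<Inter>h\<in>{h. bounded (h ` X)}.
    {m :: ('a \<Rightarrow> real) \<Rightarrow> real. m (\<lambda>x\<in>X. f x + h x) = m f + m h}"
  let ?H = "\<Inter>f\<in>{f. bounded (f ` X)}. \<Inter>c.
    {m :: ('a \<Rightarrow> real) \<Rightarrow> real. m (\<lambda>x\<in>X. c * f x) = c * m f}"
  have "closed ?A" "closed ?H"
    by (intro closed_INT ballI closed_Collect_eq continuous_intros continuous_on_product_coordinates)+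
  then have "compact (?K \<inter> (?A \<inter> ?H))" using K by (intro compact_Int_closed closed_Int)
  moreover have "{m. linear_mean m} = ?K \<inter> (?A \<inter> ?H)"
    by (rule Set.set_eqI) (simp add: linear_mean_def PiE_iff del: atLeastAtMost_iff)
  ultimately show ?thesis by simp
qed

lemma bounded_real_image_iff:
  "bounded (f ` X) \<longleftrightarrow> (\<exists>b. \<forall>x\<in>X. \<bar>f x\<bar> \<le> b)" for f :: "'a \<Rightarrow> real"
  by (simp add: bounded_iff)

lemma linear_mean_average:
  fixes p :: "'i \<Rightarrow> 'a"
  assumes I: "finite I" "I \<noteq> {}" and p: "\<And>i. i \<in> I \<Longrightarrow> p i \<in> X"
  shows "linear_mean (\<lambda>f. if bounded (f ` X) then (\<Sum>i\<in>I. f (p i)) / real (card I) else 0)"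
proof -
  have n: "0 < real (card I)" using I by (simp add: card_gt_0_iff)
  have add: "bounded ((\<lambda>x\<in>X. f x + h x) ` X)" if bd: "bounded (f ` X)" "bounded (h ` X)"
    for f h :: "'a \<Rightarrow> real"
  proof -
    obtain b c where "\<forall>x\<in>X. \<bar>f x\<bar> \<le> b" "\<forall>x\<in>X. \<bar>h x\<bar> \<le> c"
      using bd by (auto simp: bounded_real_image_iff)
    then show ?thesis by (force simp: bounded_real_image_iff intro!: exI[of _ "b + c"])
  qed
  have scale: "bounded ((\<lambda>x\<in>X. c * f x) ` X)" if bd: "bounded (f ` X)"
    for f :: "'a \<Rightarrow> real" and c
  proof -
    obtain b where "\<forall>x\<in>X. \<bar>f x\<bar> \<le> b"
      using bd by (auto simp: bounded_real_image_iff)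
    then show ?thesis
      by (auto simp: bounded_real_image_iff abs_mult intro!: exI[of _ "\<bar>c\<bar> * b"] mult_left_mono)
  qed
  have bds: "(\<Sum>i\<in>I. f (p i)) / real (card I) \<in> {(INF x\<in>X. f x)..(SUP x\<in>X. f x)}"
    if "bounded (f ` X)" for f :: "'a \<Rightarrow> real"
  proof -
    have "(INF x\<in>X. f x) \<le> f (p i)" "f (p i) \<le> (SUP x\<in>X. f x)" if "i \<in> I" for i
      using p[OF that] \<open>bounded (f ` X)\<close>
      by (auto intro: cINF_lower cSUP_upper bounded_imp_bdd_below bounded_imp_bdd_above)
    then have "real (card I) * (INF x\<in>X. f x) \<le> (\<Sum>i\<in>I. f (p i))"
      "(\<Sum>i\<in>I. f (p i)) \<le> real (card I) * (SUP x\<in>X. f x)"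
      by (auto intro: sum_bounded_below sum_bounded_above)
    then show ?thesis using n by (simp add: le_divide_eq divide_le_eq mult.commute)
  qed
  show ?thesis
    unfolding linear_mean_def
    using add scale bds p
    by (auto simp: sum.distrib add_divide_distrib sum_distrib_left cong: sum.cong)
qed

text \<open>The conditions \<open>\<bar>m f - m (f \<circ> g)\<bar> \<le> e\<close> cut out closed sets of linear means. Any finitely many of
them are satisfied by averaging over points chosen in the members of a minimal refinement of an
almost invariant covering. By compactness some linear mean satisfies them all.\<close>

lemma amenable_if_almost_invariant_coverings:
  assumes inv: "\<And>F \<U> e. finite F \<Longrightarrow> F \<subseteq> G \<Longrightarrow> \<U> \<in> fin_unif \<Longrightarrow> (0::real) < e \<Longrightarrow>
    \<exists>\<V>\<in>fin_unif. \<U> \<preceq> \<V> \<and>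
      (\<forall>g\<in>F. real (N (cov_join \<V> (image_covering g \<V>))) \<le> (1 + e) * real (N \<V>))"
  shows "amenable X \<D> G"
proof -
  let ?L = "{m. linear_mean m}"
  let ?I = "UC_b X \<D> \<times> G \<times> {0::real<..}"
  let ?C = "\<lambda>(f, g, e). {m :: ('a \<Rightarrow> real) \<Rightarrow> real. \<bar>m f - m (compose X f g)\<bar> \<le> e}"
  have "?L \<inter> (\<Inter>i\<in>?I. ?C i) \<noteq> {}"
  proof (rule compact_imp_fip_image[OF compact_linear_means])
    fix i assume "i \<in> ?I"
    show "closed (?C i)"
      by (cases i) (auto intro!: closed_Collect_le continuous_intros continuous_on_product_coordinates)
  next
    fix T assume T: "finite T" "T \<subseteq> ?I"
    have "\<forall>f\<in>UC_b X \<D>. \<exists>B. \<forall>x\<in>X. \<bar>f x\<bar> \<le> B"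
      by (auto simp: UC_b_def bounded_iff)
    then obtain B where B: "\<And>f x. f \<in> UC_b X \<D> \<Longrightarrow> x \<in> X \<Longrightarrow> \<bar>f x\<bar> \<le> B f"
      by metis
    \<comment> \<open>The factor of \<open>\<eta>\<close> is the error constant of the estimate for samples over a covering.\<close>
    have "\<forall>\<^sub>F \<eta> in at_right 0. \<forall>(f, g, e)\<in>T. \<eta> * (2 * B f + 8) < e"
    proof (subst eventually_ball_finite_distrib[OF T(1)], clarify)
      fix f g e assume "(f, g, e) \<in> T"
      then have "0 < e" using T(2) by auto
      have "((\<lambda>\<eta>. \<eta> * (2 * B f + 8)) \<longlongrightarrow> 0 * (2 * B f + 8)) (at_right 0)"
        by (intro tendsto_intros)
      then show "\<forall>\<^sub>F \<eta> in at_right 0. \<eta> * (2 * B f + 8) < e"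
        using \<open>0 < e\<close> by (intro order_tendstoD(2)) auto
    qed
    moreover have "\<forall>\<^sub>F \<eta> in at_right (0::real). \<eta> \<in> {0<..<1}"
      by (rule eventually_at_right_real) simp
    ultimately have "\<forall>\<^sub>F \<eta> in at_right 0.
        (\<forall>(f, g, e)\<in>T. \<eta> * (2 * B f + 8) < e) \<and> \<eta> \<in> {0<..<1}"
      by (rule eventually_conj)
    then obtain \<eta> where \<eta>: "\<And>f g e. (f, g, e) \<in> T \<Longrightarrow> \<eta> * (2 * B f + 8) < e" "0 < \<eta>" "\<eta> < 1"
      using eventually_happens'[OF trivial_limit_at_right_real] by fastforce
    \<comment> \<open>The covering must control both \<open>f\<close> and its translate \<open>f \<circ> g\<close>, as samples are taken in \<open>\<V>\<close> and in \<open>g(\<V>)\<close>.\<close>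
    let ?H = "fst ` T \<union> (\<lambda>(f, g, e). compose X f g) ` T"
    have H: "?H \<subseteq> UC_b X \<D>" using T(2) UC_b_compose by auto
    have "\<forall>h\<in>?H. \<exists>\<U>\<in>fin_unif. \<forall>U\<in>\<U>. \<forall>x\<in>U. \<forall>y\<in>U. \<bar>h x - h y\<bar> \<le> \<eta>"
      using small_oscillation_covering \<eta>(2) H by blast
    then obtain c where c: "\<And>h. h \<in> ?H \<Longrightarrow> c h \<in> fin_unif"
      "\<And>h U x y. h \<in> ?H \<Longrightarrow> U \<in> c h \<Longrightarrow> x \<in> U \<Longrightarrow> y \<in> U \<Longrightarrow> \<bar>h x - h y\<bar> \<le> \<eta>"
      by metis
    have "finite ?H" using T(1) by simp
    then obtain \<U>0 where U0: "\<U>0 \<in> fin_unif" "\<And>h. h \<in> ?H \<Longrightarrow> c h \<preceq> \<U>0"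
      using uniform_common_refinement_finite[of ?H c] c(1) by metis
    let ?F = "(\<lambda>(f, g, e). g) ` T"
    have F: "finite ?F" "?F \<subseteq> G" using T by auto
    obtain \<U> where U: "\<U> \<in> fin_unif" "\<U>0 \<preceq> \<U>"
      and invU: "\<And>g. g \<in> ?F \<Longrightarrow> real (N (cov_join \<U> (image_covering g \<U>))) \<le> (1 + \<eta>) * real (N \<U>)"
      using inv[OF F U0(1) \<eta>(2)] by blast
    have osc: "\<bar>h x - h y\<bar> \<le> \<eta>" if h: "h \<in> ?H" "U \<in> \<U>" "x \<in> U" "y \<in> U" for h U x y
    proof -
      have "c h \<preceq> \<U>" using refined_by_trans[OF U0(2)[OF h(1)] U(2)] .
      then obtain U' where "U' \<in> c h" "U \<subseteq> U'" using h(2) by (auto simp: refined_by_def)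
      then show ?thesis using c(2)[OF h(1)] h(3,4) by blast
    qed
    obtain \<V> where V: "\<V> \<in> fin_unif" "\<U> \<preceq> \<V>" "card \<V> = N \<U>" "{} \<notin> \<V>"
      using minimal_refinement[OF U(1)] by metis
    then have "\<forall>V\<in>\<V>. \<exists>x. x \<in> V" by (metis equals0I)
    then obtain p where p: "\<And>V. V \<in> \<V> \<Longrightarrow> p V \<in> V" by metis
    have pX: "p V \<in> X" if "V \<in> \<V>" for V using p[OF that] fin_unifD(4)[OF V(1) that] by blast
    have n: "0 < real (card \<V>)" using V(3) N_pos[OF U(1)] by simp
    let ?m = "\<lambda>f. if bounded (f ` X) then (\<Sum>V\<in>\<V>. f (p V)) / real (card \<V>) else 0"
    have "linear_mean ?m"
      using n pX fin_unifD(1)[OF V(1)] by (intro linear_mean_average) auto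
    moreover have "?m \<in> ?C i" if "i \<in> T" for i
    proof -
      obtain f g e where i: "i = (f, g, e)" by (cases i)
      have fge: "f \<in> UC_b X \<D>" "g \<in> G" "0 < e" using that T(2) i by auto
      have bd: "bounded (f ` X)" "bounded (compose X f g ` X)"
        using fge(1) UC_b_compose[OF fge(1,2)] by (auto simp: UC_b_def)
      have gF: "g \<in> ?F" and fH: "f \<in> ?H" "compose X f g \<in> ?H"
        using that i by force+
      have osc_f: "\<bar>f x - f y\<bar> \<le> \<eta>" if "U \<in> \<U>" "x \<in> U" "y \<in> U" for U x y
        using osc[OF fH(1) that] .
      have osc_g: "\<bar>f (g x) - f (g y)\<bar> \<le> \<eta>" if "U \<in> \<U>" "x \<in> U" "y \<in> U" for U x y
        using osc[OF fH(2) that] fin_unifD(4)[OF U(1) that(1)] that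
        by (auto simp: compose_def subset_iff)
      have 1: "(\<Sum>V\<in>\<V>. f (p V)) \<le> (\<Sum>V\<in>\<V>. f (g (p V))) + real (card \<V>) * (\<eta> * (2 * B f + 8))"
        using \<eta>(2,3) B[OF fge(1)] osc_f osc_g p
        by (intro sum_almost_invariant[OF fge(2) U(1) V(1-3) invU[OF gF]]) auto
      \<comment> \<open>The estimate is one-sided; applied to \<open>- f\<close> it gives the opposite inequality.\<close>
      have 2: "(\<Sum>V\<in>\<V>. - f (p V)) \<le> (\<Sum>V\<in>\<V>. - f (g (p V))) + real (card \<V>) * (\<eta> * (2 * B f + 8))"
        using \<eta>(2,3) B[OF fge(1)] osc_f osc_g p
        by (intro sum_almost_invariant[OF fge(2) U(1) V(1-3) invU[OF gF], where f = "\<lambda>x. - f x"])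
          (auto simp: abs_minus_commute)
      have "\<bar>(\<Sum>V\<in>\<V>. f (p V)) - (\<Sum>V\<in>\<V>. f (g (p V)))\<bar> \<le> real (card \<V>) * (\<eta> * (2 * B f + 8))"
        using 1 2 by (simp add: sum_negf abs_le_iff)
      also have "\<dots> \<le> real (card \<V>) * e"
        using \<eta>(1)[of f g e] that i n by (intro mult_left_mono) auto
      finally have "\<bar>(\<Sum>V\<in>\<V>. f (p V)) / real (card \<V>) - (\<Sum>V\<in>\<V>. f (g (p V))) / real (card \<V>)\<bar> \<le> e"
        using n by (simp add: diff_divide_distrib[symmetric] divide_le_eq mult.commute)
      moreover have "(\<Sum>V\<in>\<V>. compose X f g (p V)) = (\<Sum>V\<in>\<V>. f (g (p V)))"
        using pX by (intro sum.cong) (auto simp: compose_def)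
      ultimately show ?thesis using bd i by simp
    qed
    ultimately show "?L \<inter> (\<Inter>i\<in>T. ?C i) \<noteq> {}" by blast
  qed
  then obtain m where m: "linear_mean m" and C: "\<And>i. i \<in> ?I \<Longrightarrow> m \<in> ?C i" by blast
  have bd: "bounded (f ` X)" if "f \<in> UC_b X \<D>" for f using that by (simp add: UC_b_def)
  have "m (compose X f g) = m f" if "f \<in> UC_b X \<D>" "g \<in> G" for f g
  proof -
    have "\<bar>m f - m (compose X f g)\<bar> \<le> 0 + e" if "0 < e" for e
      using C[of "(f, g, e)"] \<open>f \<in> UC_b X \<D>\<close> \<open>g \<in> G\<close> that by auto
    then have "\<bar>m f - m (compose X f g)\<bar> \<le> 0" by (rule field_le_epsilon)
    then show ?thesis by simp
  qed
  moreover have "m f \<in> {(INF x\<in>X. f x)..(SUP x\<in>X. f x)}" if "f \<in> UC_b X \<D>" for f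
  proof -
    have "m f \<in> (if bounded (f ` X) then {(INF x\<in>X. f x)..(SUP x\<in>X. f x)} else {0})"
      using m unfolding linear_mean_def by blast
    then show ?thesis using bd[OF that] by simp
  qed
  ultimately show ?thesis
    using m bd unfolding amenable_def linear_mean_def
    by (intro exI[of _ m]) (simp add: atLeastAtMost_iff[symmetric] del: atLeastAtMost_iff)
qed

end

section \<open>Systems of entropy zero\<close>

theorem theorem9p3:
  fixes X :: "'a set" and \<D> :: "'a set set set" and G E :: "('a \<Rightarrow> 'a) set"
  assumes "dynamical_system X \<D> G"
    and "finite_symmetric_generating_set X \<D> G E"
    and "(\<lambda>x\<in>X. x) \<in> E"
    and "topological_entropy X \<D> E = 0"
  shows "asymptotic_uniform_complexity \<D> G = 1 \<and> amenable X \<D> G"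
proof -
  interpret covering_dynamical_system X \<D> G
    using assms(1)
    by (simp add: dynamical_system_def covering_uniform_space_def
        covering_dynamical_system_def covering_dynamical_system_axioms_def)
  have "topological_entropy X \<D> E \<le> 0" using assms(4) by simp
  note almost_invariant_covering[OF assms(2,3) this]
  then show ?thesis
    using asymptotic_uniform_complexity_eq_1 amenable_if_almost_invariant_coverings by blast
qed

end
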